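(* There exist positive numerical constants $c,c',c_3$ such that the following holds for all integers $p\ge q\ge2$, any matrix $\mathbf A\in\mathbb R^{p\times q}$ and any $t>0$. Provided that $$\|\mathbf A\|_2^2\ge c(\sqrt{pqt}+t)\quad\text{and}\quad\|\mathbf A\|_\infty\ge c\big[\sqrt t+(pq)^{1/4}+(pt)^{1/4}\big],$$ then, with probability higher than $1-c_3e^{-t}$, $$\frac{|\widehat{\mathrm{ER}}_{2,\infty}(\mathbf A)-\mathrm{ER}_{2,\infty}(\mathbf A)|}{\mathrm{ER}_{2,\infty}(\mathbf A)}\le c'\Big[\frac{\sqrt{pqt}}{\|\mathbf A\|_2^2}+\frac{\sqrt{pt}+\sqrt{pq}}{\|\mathbf A\|_\infty^2}+\frac{\sqrt q+\sqrt t}{\|\mathbf A\|_\infty}\Big].$$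
   Context: $\mathbf Y=\mathbf A+\mathbf E$, where $\mathbf A$ is a deterministic real $p\times q$ matrix and $\mathbf E$ is a $p\times q$ random matrix with independent standard normal entries. $\|\cdot\|_2$ is the Frobenius norm and $\|\cdot\|_\infty$ the operator norm (largest singular value). The effective rank is $\mathrm{ER}_{2,\infty}(\mathbf A)=\|\mathbf A\|_2^2/\|\mathbf A\|_\infty^2$, and its estimator is $$\widehat{\mathrm{ER}}_{2,\infty}(\mathbf A)=\max\Big[\frac{\mathrm{tr}[\mathbf Y^T\mathbf Y-p\mathbf I_q]}{\|\mathbf Y^T\mathbf Y-p\mathbf I_q\|_\infty},\,1\Big],$$ with $\mathbf I_q$ the $q\times q$ identity matrix. *)

theory Defs
  imports "HOL-Probability.Probability" "Jordan_Normal_Form.Matrix"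
begin

text \<open>
  The constants of the theorem are uniform in the dimensions, so matrices are the
  carrier-based ones of \<open>Jordan_Normal_Form\<close>. Several names and notations clash with
  \<open>HOL-Analysis\<close>; prefix and qualified forms are used below.
\<close>

definition vec_norm2 :: "real vec \<Rightarrow> real" where
  "vec_norm2 v = sqrt (scalar_prod v v)"

definition frobenius_norm :: "real mat \<Rightarrow> real" where
  "frobenius_norm A = sqrt (\<Sum>i<dim_row A. \<Sum>j<dim_col A. (A $$ (i, j))\<^sup>2)"

text \<open>
  The operator norm for the Euclidean norms, i.e. the largest singular value, in the form of
  \<^const>\<open>onorm\<close>: the zero vector contributes \<open>0 / 0 = 0\<close>.
  The quotients are bounded, see \<open>bdd_above_operator_norm\<close> below.
\<close>
definition operator_norm :: "real mat \<Rightarrow> real" where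
  "operator_norm A =
     (SUP v\<in>carrier_vec (dim_col A). vec_norm2 (mult_mat_vec A v) / vec_norm2 v)"

definition mat_trace :: "real mat \<Rightarrow> real" where
  "mat_trace A = (\<Sum>i<dim_row A. A $$ (i, i))"

definition effective_rank :: "real mat \<Rightarrow> real" where
  "effective_rank A = (frobenius_norm A)\<^sup>2 / (operator_norm A)\<^sup>2"

text \<open>The matrix \<open>Y\<^sup>T Y - p I\<^sub>q\<close> for an observation \<open>Y\<close> of size \<open>p \<times> q\<close>.\<close>
definition centered_gram :: "real mat \<Rightarrow> real mat" where
  "centered_gram Y =
     transpose_mat Y * Y - smult_mat (real (dim_row Y)) (one_mat (dim_col Y))"

definition effective_rank_estimator :: "real mat \<Rightarrow> real" where
  "effective_rank_estimator Y =
     max (mat_trace (centered_gram Y) / operator_norm (centered_gram Y)) 1"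

text \<open>
  The joint law of the entries of a \<open>p \<times> q\<close> matrix with independent standard normal entries.
  Working with this law rather than with a random matrix on an arbitrary probability space
  keeps the constants from depending on the type of the sample space; by
  \<open>distr_eq_std_normal_entries\<close> below it is the law of every such family of random variables.
\<close>
definition std_normal_entries :: "nat \<Rightarrow> nat \<Rightarrow> (nat \<times> nat \<Rightarrow> real) measure" where
  "std_normal_entries p q =
     PiM ({..<p} \<times> {..<q}) (\<lambda>_. density lborel (\<lambda>x. ennreal (std_normal_density x)))"

lemma (in prob_space) distr_eq_std_normal_entries:
  fixes X :: "nat \<times> nat \<Rightarrow> 'a \<Rightarrow> real"
  assumes p: "0 < p" and q: "0 < q"
    and indep: "indep_vars (\<lambda>_. borel) X ({..<p} \<times> {..<q})"
    and dist: "\<And>k. k \<in> {..<p} \<times> {..<q} \<Longrightarrow> distributed M lborel (X k) std_normal_density"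
  shows "distr M (PiM ({..<p} \<times> {..<q}) (\<lambda>_. borel)) (\<lambda>\<omega>. \<lambda>k\<in>{..<p} \<times> {..<q}. X k \<omega>)
         = std_normal_entries p q"
proof -
  let ?I = "{..<p} \<times> {..<q}"
  have rv: "random_variable borel (X k)" if "k \<in> ?I" for k
    using distributed_measurable[OF dist[OF that]] by simp
  have "distr M (PiM ?I (\<lambda>_. borel)) (\<lambda>\<omega>. \<lambda>k\<in>?I. X k \<omega>) = PiM ?I (\<lambda>k. distr M borel (X k))"
    using indep_vars_iff_distr_eq_PiM'[of ?I X "\<lambda>_. borel"] p q rv indep
    by (auto simp: lessThan_empty_iff)
  also have "\<dots> = std_normal_entries p q"
    unfolding std_normal_entries_def
  proof (rule PiM_cong)
    fix k assume k: "k \<in> ?I"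
    have "distr M borel (X k) = distr M lborel (X k)"
      by (rule distr_cong) auto
    then show "distr M borel (X k) = density lborel (\<lambda>x. ennreal (std_normal_density x))"
      using distributed_distr_eq_density[OF dist[OF k]] by simp
  qed simp
  finally show ?thesis .
qed

lemma vec_norm2_eq: "vec_norm2 v = sqrt (\<Sum>i<dim_vec v. (vec_index v i)\<^sup>2)"
  by (simp add: vec_norm2_def scalar_prod_def power2_eq_square atLeast0LessThan)

lemma vec_norm2_mult_le:
  assumes v: "v \<in> carrier_vec (dim_col A)"
  shows "vec_norm2 (mult_mat_vec A v) \<le> frobenius_norm A * vec_norm2 v"
proof -
  have "(vec_index (mult_mat_vec A v) i)\<^sup>2
          \<le> (\<Sum>j<dim_col A. (A $$ (i, j))\<^sup>2) * (\<Sum>j<dim_col A. (vec_index v j)\<^sup>2)"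
    if "i < dim_row A" for i
    using that v Cauchy_Schwarz_ineq_sum[of "\<lambda>j. A $$ (i, j)" "\<lambda>j. vec_index v j" "{..<dim_col A}"]
    by (simp add: scalar_prod_def atLeast0LessThan)
  then have "(\<Sum>i<dim_row A. (vec_index (mult_mat_vec A v) i)\<^sup>2)
      \<le> (\<Sum>i<dim_row A. (\<Sum>j<dim_col A. (A $$ (i, j))\<^sup>2) * (\<Sum>j<dim_col A. (vec_index v j)\<^sup>2))"
    by (intro sum_mono) auto
  then show ?thesis
    using v by (simp add: vec_norm2_eq frobenius_norm_def flip: real_sqrt_mult sum_distrib_right)
qed

lemma bdd_above_operator_norm:
  "bdd_above ((\<lambda>v. vec_norm2 (mult_mat_vec A v) / vec_norm2 v) ` carrier_vec (dim_col A))"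
proof (intro bdd_aboveI2)
  fix v :: "real vec"
  assume v: "v \<in> carrier_vec (dim_col A)"
  have "0 \<le> vec_norm2 v" "0 \<le> frobenius_norm A"
    by (auto simp: vec_norm2_eq frobenius_norm_def intro!: sum_nonneg)
  then show "vec_norm2 (mult_mat_vec A v) / vec_norm2 v \<le> frobenius_norm A"
    using vec_norm2_mult_le[OF v] by (cases "vec_norm2 v = 0") (auto simp: divide_le_eq)
qed

end

theory Submission
  imports Defs
begin

text \<open>
  Write \<open>F\<close> and \<open>L\<close> for the Frobenius and the operator norm of \<open>A\<close>. The numerator of the estimator
  estimates \<open>F\<^sup>2\<close> and its denominator estimates \<open>L\<^sup>2\<close>, so the theorem follows from a concentration
  bound for each of them together with a perturbation bound for quotients
  (\<open>relative_error_of_quotient\<close>).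

  Both concentration bounds rest on the same tail estimate, \<open>centered_sum_tail\<close>, for noncentral
  chi-squared variables: if \<open>g\<close> is a standard Gaussian vector in dimension \<open>n\<close> and \<open>a\<close> is a fixed vector,
  then \<open>|a + g|\<^sup>2 - n - |a|\<^sup>2\<close> is at most of order \<open>sqrt (t (n + |a|\<^sup>2)) + t\<close> outside an event of
  probability \<open>2 exp (- t)\<close>. It follows from Chernoff's method.

  The trace of the centered Gram matrix is \<open>|A + E|\<^sup>2 - p q\<close> in Frobenius norm, which is directly
  of this form with \<open>n = p q\<close>. For the operator norm, let \<open>D\<close> be the difference of the centered Gram
  matrix and \<open>A\<^sup>T A\<close>. For a unit vector \<open>w\<close> the value \<open>w \<bullet> D w\<close> is \<open>|A w + E w|\<^sup>2 - p - |A w|\<^sup>2\<close>, and \<open>E w\<close>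
  is a standard Gaussian vector in dimension \<open>p\<close>, so the tail estimate applies with \<open>n = p\<close>. A union
  bound over a net of the unit sphere with at most \<open>exp (6 q)\<close> points, at the level \<open>t + 6 q\<close>, controls
  \<open>D\<close> on all unit vectors at once (\<open>operator_norm_deviation_tail\<close>). The net consists of lattice points,
  which are counted by a generating function.

  The lower bound on \<open>L\<close> makes the error of the denominator at most \<open>L\<^sup>2 / 2\<close>. All remaining terms
  are then of the three kinds in the theorem.
\<close>

section \<open>Norms and quadratic forms\<close>

lemma vec_norm2_nonneg: "0 \<le> vec_norm2 v"
  by (simp add: vec_norm2_eq sum_nonneg)

lemma vec_norm2_square: "(vec_norm2 v)\<^sup>2 = scalar_prod v v"
  by (simp add: vec_norm2_def scalar_prod_def sum_nonneg)

lemma vec_norm2_smult: "vec_norm2 (smult_vec k v) = \<bar>k\<bar> * vec_norm2 v"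
  by (simp add: vec_norm2_def real_sqrt_mult flip: mult.assoc)

lemma vec_norm2_eq_0_iff:
  assumes "v \<in> carrier_vec n"
  shows "vec_norm2 v = 0 \<longleftrightarrow> v = zero_vec n"
proof
  assume "vec_norm2 v = 0"
  then have "\<forall>i<dim_vec v. (vec_index v i)\<^sup>2 = 0"
    by (simp add: vec_norm2_eq sum_nonneg_eq_0_iff)
  then show "v = zero_vec n" using assms by (intro eq_vecI) auto
qed (simp add: vec_norm2_eq)

lemma scalar_prod_le_vec_norm2:
  assumes "u \<in> carrier_vec n" "v \<in> carrier_vec n"
  shows "\<bar>scalar_prod u v\<bar> \<le> vec_norm2 u * vec_norm2 v"
proof -
  have "(scalar_prod u v)\<^sup>2 \<le> (vec_norm2 u * vec_norm2 v)\<^sup>2"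
    using Cauchy_Schwarz_ineq_sum[of "vec_index u" "vec_index v" "{..<n}"] assms
    by (simp add: scalar_prod_def atLeast0LessThan vec_norm2_eq sum_nonneg power_mult_distrib)
  then show ?thesis
    by (metis abs_le_square_iff abs_mult abs_of_nonneg vec_norm2_nonneg)
qed

lemma vec_norm2_triangle_ineq:
  assumes "u \<in> carrier_vec n" "v \<in> carrier_vec n"
  shows "vec_norm2 (u + v) \<le> vec_norm2 u + vec_norm2 v"
  using L2_set_triangle_ineq[of "vec_index u" "vec_index v" "{..<n}"] assms
  by (simp add: vec_norm2_eq L2_set_def)

lemma vec_norm2_le_operator_norm:
  assumes "v \<in> carrier_vec (dim_col A)"
  shows "vec_norm2 (mult_mat_vec A v) \<le> operator_norm A * vec_norm2 v"
proof (cases "vec_norm2 v = 0")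
  case True
  then have "v = zero_vec (dim_col A)" using assms vec_norm2_eq_0_iff by blast
  then show ?thesis using True by (simp add: vec_norm2_eq)
next
  case False
  then have "vec_norm2 v > 0" using vec_norm2_nonneg[of v] by linarith
  moreover have "vec_norm2 (mult_mat_vec A v) / vec_norm2 v \<le> operator_norm A"
    unfolding operator_norm_def by (rule cSUP_upper[OF assms bdd_above_operator_norm])
  ultimately show ?thesis by (simp add: divide_le_eq)
qed

lemma operator_norm_le:
  assumes "0 \<le> K"
    and "\<And>v. v \<in> carrier_vec (dim_col A) \<Longrightarrow> vec_norm2 (mult_mat_vec A v) \<le> K * vec_norm2 v"
  shows "operator_norm A \<le> K"
  unfolding operator_norm_def
proof (rule cSUP_least)
  show "carrier_vec (dim_col A) \<noteq> ({} :: real vec set)" using zero_carrier_vec by blast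
next
  fix v :: "real vec" assume v: "v \<in> carrier_vec (dim_col A)"
  show "vec_norm2 (mult_mat_vec A v) / vec_norm2 v \<le> K"
    using assms(1) assms(2)[OF v] vec_norm2_nonneg[of v]
    by (cases "vec_norm2 v = 0") (auto simp: divide_le_eq)
qed

lemma operator_norm_nonneg: "0 \<le> operator_norm A"
proof -
  have "0 = vec_norm2 (mult_mat_vec A (zero_vec (dim_col A))) / vec_norm2 (zero_vec (dim_col A) :: real vec)"
    by (simp add: vec_norm2_eq)
  also have "\<dots> \<le> operator_norm A"
    unfolding operator_norm_def by (rule cSUP_upper[OF _ bdd_above_operator_norm]) simp
  finally show ?thesis .
qed

lemma operator_norm_le_frobenius_norm: "operator_norm A \<le> frobenius_norm A"
  by (rule operator_norm_le) (auto simp: frobenius_norm_def intro!: sum_nonneg vec_norm2_mult_le[unfolded frobenius_norm_def])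

lemma polarization:
  fixes M :: "real mat"
  assumes M: "M \<in> carrier_mat n n" and sym: "transpose_mat M = M"
    and u: "u \<in> carrier_vec n" and v: "v \<in> carrier_vec n"
  shows "scalar_prod (u + v) (mult_mat_vec M (u + v)) =
           scalar_prod u (mult_mat_vec M u) + 2 * scalar_prod u (mult_mat_vec M v)
             + scalar_prod v (mult_mat_vec M v)"
    and "scalar_prod (u - v) (mult_mat_vec M (u - v)) =
           scalar_prod u (mult_mat_vec M u) - 2 * scalar_prod u (mult_mat_vec M v)
             + scalar_prod v (mult_mat_vec M v)"
    and "scalar_prod (u - v) (mult_mat_vec M (u + v)) =
           scalar_prod u (mult_mat_vec M u) - scalar_prod v (mult_mat_vec M v)"
proof -
  have Mu: "mult_mat_vec M u \<in> carrier_vec n" and Mv: "mult_mat_vec M v \<in> carrier_vec n"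
    using M u v by auto
  have swap: "scalar_prod v (mult_mat_vec M u) = scalar_prod u (mult_mat_vec M v)"
    using transpose_vec_mult_scalar[OF M u v] comm_scalar_prod[OF Mv u] sym by simp
  show "scalar_prod (u + v) (mult_mat_vec M (u + v)) =
           scalar_prod u (mult_mat_vec M u) + 2 * scalar_prod u (mult_mat_vec M v)
             + scalar_prod v (mult_mat_vec M v)"
    using u v Mu Mv swap
    by (simp add: mult_add_distrib_mat_vec[OF M u v] add_scalar_prod_distrib[of _ n]
        scalar_prod_add_distrib[of _ n])
  show "scalar_prod (u - v) (mult_mat_vec M (u - v)) =
           scalar_prod u (mult_mat_vec M u) - 2 * scalar_prod u (mult_mat_vec M v)
             + scalar_prod v (mult_mat_vec M v)"
    using u v Mu Mv swap
    by (simp add: mult_minus_distrib_mat_vec[OF M u v] minus_scalar_prod_distrib[of _ n]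
        scalar_prod_minus_distrib[of _ n])
  show "scalar_prod (u - v) (mult_mat_vec M (u + v)) =
           scalar_prod u (mult_mat_vec M u) - scalar_prod v (mult_mat_vec M v)"
    using u v Mu Mv swap
    by (simp add: mult_add_distrib_mat_vec[OF M u v] minus_scalar_prod_distrib[of _ n]
        scalar_prod_add_distrib[of _ n])
qed

text \<open>
  Polarization and the parallelogram law bound the form by the arithmetic mean of the squared
  norms. Rescaling both vectors to a common norm turns this mean into the product of the norms.
\<close>
lemma symmetric_bilinear_form_le:
  fixes M :: "real mat"
  assumes M: "M \<in> carrier_mat n n" and sym: "transpose_mat M = M"
    and K: "\<And>v. v \<in> carrier_vec n \<Longrightarrow> \<bar>scalar_prod v (mult_mat_vec M v)\<bar> \<le> K * scalar_prod v v"
    and u: "u \<in> carrier_vec n" and v: "v \<in> carrier_vec n"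
  shows "\<bar>scalar_prod u (mult_mat_vec M v)\<bar> \<le> K * (vec_norm2 u * vec_norm2 v)"
proof -
  \<comment> \<open>the factor \<open>1 / 2\<close> is \<open>2 / 4\<close>, from the parallelogram law and polarization\<close>
  have half: "\<bar>scalar_prod x (mult_mat_vec M y)\<bar> \<le> K * (scalar_prod x x + scalar_prod y y) / 2"
    if x: "x \<in> carrier_vec n" and y: "y \<in> carrier_vec n" for x y
  proof -
    have id: "mult_mat_vec (one_mat n) z = z" if "z \<in> carrier_vec n" for z :: "real vec"
      using that by simp
    have "scalar_prod (x + y) (x + y) + scalar_prod (x - y) (x - y)
            = 2 * (scalar_prod x x + scalar_prod y y)"
      using polarization(1,2)[of "one_mat n" n x y] x y by (simp add: id)
    then have "K * scalar_prod (x + y) (x + y) + K * scalar_prod (x - y) (x - y)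
            = 2 * (K * (scalar_prod x x + scalar_prod y y))"
      by (metis distrib_left mult.left_commute)
    then show ?thesis
      using polarization(1,2)[OF M sym x y] K[of "x + y"] K[of "x - y"] x y by simp
  qed
  show ?thesis
  proof (cases "vec_norm2 u = 0 \<or> vec_norm2 v = 0")
    case True
    then have "u = zero_vec n \<or> v = zero_vec n" using u v vec_norm2_eq_0_iff by blast
    then show ?thesis
    proof
      assume "u = zero_vec n"
      then show ?thesis using M v True by (auto simp: vec_norm2_eq)
    next
      assume z: "v = zero_vec n"
      have "mult_mat_vec M v = zero_vec n" using M z by (intro eq_vecI) auto
      then show ?thesis using u z by (simp add: vec_norm2_eq)
    qed
  next
    case False
    then have pos: "0 < vec_norm2 u * vec_norm2 v"
      using vec_norm2_nonneg[of u] vec_norm2_nonneg[of v] by simp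
    let ?x = "smult_vec (vec_norm2 v) u" and ?y = "smult_vec (vec_norm2 u) v"
    have "scalar_prod ?x (mult_mat_vec M ?y) = (vec_norm2 u * vec_norm2 v) * scalar_prod u (mult_mat_vec M v)"
      using M u v by (simp add: mult_mat_vec[OF M v])
    moreover have "scalar_prod ?x ?x + scalar_prod ?y ?y
        = 2 * ((vec_norm2 u * vec_norm2 v) * (vec_norm2 u * vec_norm2 v))"
      using vec_norm2_nonneg[of u] vec_norm2_nonneg[of v]
      by (simp add: power2_eq_square vec_norm2_smult flip: vec_norm2_square)
    ultimately have "(vec_norm2 u * vec_norm2 v) * \<bar>scalar_prod u (mult_mat_vec M v)\<bar>
        \<le> (vec_norm2 u * vec_norm2 v) * (K * (vec_norm2 u * vec_norm2 v))"
      using half[of ?x ?y] u v vec_norm2_nonneg[of u] vec_norm2_nonneg[of v] by (simp add: abs_mult mult_ac)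
    then show ?thesis using pos by (simp only: mult_le_cancel_left_pos)
  qed
qed

text \<open>
  The bilinear estimate is applied to the vectors \<open>M v\<close> and \<open>v\<close>. Reducing the operator norm to
  the quadratic form is what makes a net of one sphere, rather than of two, enough.
\<close>
lemma operator_norm_symmetric_le:
  assumes M: "M \<in> carrier_mat n n" and sym: "transpose_mat M = M" and "0 \<le> K"
    and K: "\<And>v. v \<in> carrier_vec n \<Longrightarrow> \<bar>scalar_prod v (mult_mat_vec M v)\<bar> \<le> K * scalar_prod v v"
  shows "operator_norm M \<le> K"
proof (rule operator_norm_le)
  fix v :: "real vec" assume "v \<in> carrier_vec (dim_col M)"
  then have v: "v \<in> carrier_vec n" using M by auto
  let ?w = "mult_mat_vec M v"
  have w: "?w \<in> carrier_vec n" using M v by auto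
  have "vec_norm2 ?w * vec_norm2 ?w \<le> vec_norm2 ?w * (K * vec_norm2 v)"
    using symmetric_bilinear_form_le[OF M sym K w v] vec_norm2_square[of ?w]
    by (simp add: power2_eq_square mult_ac)
  then show "vec_norm2 ?w \<le> K * vec_norm2 v"
    using vec_norm2_nonneg[of ?w] vec_norm2_nonneg[of v] \<open>0 \<le> K\<close>
    by (cases "vec_norm2 ?w = 0") (auto simp: mult_le_cancel_left)
qed fact

text \<open>
  Let \<open>K\<close> be the supremum of the form over the unit sphere. Replacing a unit vector by a point of
  \<open>N\<close> costs a value of the bilinear form at \<open>v - w\<close> and \<open>v + w\<close>, hence at most
  \<open>K * 1/4 * 2\<close>. Therefore \<open>K \<le> B + K / 2\<close>, and finiteness of \<open>K\<close> allows the
  absorption.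
\<close>
lemma quadratic_form_le_of_net:
  fixes M :: "real mat"
  assumes M: "M \<in> carrier_mat n n" and sym: "transpose_mat M = M"
    and net: "\<And>v. v \<in> carrier_vec n \<Longrightarrow> vec_norm2 v = 1 \<Longrightarrow>
       \<exists>w\<in>N. w \<in> carrier_vec n \<and> vec_norm2 w \<le> 1 \<and> vec_norm2 (v - w) \<le> 1 / 4"
    and B: "\<And>w. w \<in> N \<Longrightarrow> \<bar>scalar_prod w (mult_mat_vec M w)\<bar> \<le> B"
    and v: "v \<in> carrier_vec n"
  shows "\<bar>scalar_prod v (mult_mat_vec M v)\<bar> \<le> 2 * B * scalar_prod v v"
proof -
  let ?U = "{u \<in> carrier_vec n. vec_norm2 u = (1 :: real)}"
  let ?Q = "\<lambda>u. \<bar>scalar_prod u (mult_mat_vec M u)\<bar>"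
  define K where "K = (SUP u\<in>?U. ?Q u)"
  have bdd: "bdd_above (?Q ` ?U)"
  proof (rule bdd_aboveI2)
    fix u assume u: "u \<in> ?U"
    then have "?Q u \<le> vec_norm2 u * vec_norm2 (mult_mat_vec M u)"
      using M by (intro scalar_prod_le_vec_norm2[of _ n]) auto
    also have "\<dots> \<le> frobenius_norm M"
      using u vec_norm2_mult_le[of u M] M by auto
    finally show "?Q u \<le> frobenius_norm M" .
  qed
  have scale: "?Q u \<le> K * scalar_prod u u" if u: "u \<in> carrier_vec n" for u
  proof (cases "vec_norm2 u = 0")
    case True
    then have "u = zero_vec n" using u vec_norm2_eq_0_iff by blast
    then show ?thesis using M by auto
  next
    case False
    let ?r = "vec_norm2 u" let ?e = "smult_vec (1 / ?r) u"
    have r: "0 < ?r" using False vec_norm2_nonneg[of u] by linarith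
    have "vec_norm2 ?e = 1" using r by (simp add: vec_norm2_smult)
    then have "?Q ?e \<le> K" unfolding K_def using u bdd by (intro cSUP_upper) auto
    moreover have "scalar_prod ?e (mult_mat_vec M ?e) = scalar_prod u (mult_mat_vec M u) / ?r\<^sup>2"
      using M u by (simp add: mult_mat_vec[OF M u] power2_eq_square)
    ultimately show ?thesis using r by (simp add: divide_le_eq flip: vec_norm2_square)
  qed
  show ?thesis
  proof (cases "?U = {}")
    \<comment> \<open>dimension zero: the sphere is empty and its supremum carries no information\<close>
    case True
    have "vec_norm2 v = 0"
    proof (rule ccontr)
      assume "vec_norm2 v \<noteq> 0"
      then have "smult_vec (1 / vec_norm2 v) v \<in> ?U"
        using v vec_norm2_nonneg[of v] by (simp add: vec_norm2_smult)
      with True show False by blast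
    qed
    then show ?thesis using scale[OF v] by (simp flip: vec_norm2_square)
  next
    case False
    have Kge: "0 \<le> K" using False bdd unfolding K_def by (auto intro: cSUP_upper2)
    have "K \<le> B + K / 2"
    proof (subst K_def, rule cSUP_least[OF False])
      fix u assume "u \<in> ?U"
      then have u: "u \<in> carrier_vec n" and u1: "vec_norm2 u = 1" by auto
      obtain w where w: "w \<in> N" "w \<in> carrier_vec n" "vec_norm2 w \<le> 1" "vec_norm2 (u - w) \<le> 1 / 4"
        using net[OF u u1] by blast
      have "vec_norm2 (u + w) \<le> 2"
        using vec_norm2_triangle_ineq[OF u w(2)] w(3) u1 by simp
      then have "vec_norm2 (u - w) * vec_norm2 (u + w) \<le> 1 / 4 * 2"
        using w(4) vec_norm2_nonneg by (intro mult_mono) auto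
      then have "K * (vec_norm2 (u - w) * vec_norm2 (u + w)) \<le> K * (1 / 2)"
        using Kge by (intro mult_left_mono) auto
      moreover have "\<bar>scalar_prod (u - w) (mult_mat_vec M (u + w))\<bar>
          \<le> K * (vec_norm2 (u - w) * vec_norm2 (u + w))"
        by (rule symmetric_bilinear_form_le[OF M sym scale]) (use u w in auto)
      ultimately show "?Q u \<le> B + K / 2"
        using polarization(3)[OF M sym u w(2)] B[OF w(1)] by linarith
    qed
    then have "K \<le> 2 * B" by simp
    then have "K * scalar_prod v v \<le> 2 * B * scalar_prod v v"
      by (intro mult_right_mono) (simp_all flip: vec_norm2_square)
    then show ?thesis using scale[OF v] by linarith
  qed
qed

section \<open>A net of the unit sphere\<close>

lemma sum_half_powers_le: "(\<Sum>k\<in>{- int m..int m}. (1 / 2 :: real) ^ nat \<bar>k\<bar>) \<le> 3 - 2 * (1 / 2) ^ m"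
proof (induction m)
  case (Suc m)
  have "{- int (Suc m)..int (Suc m)} = insert (- int (Suc m)) (insert (int (Suc m)) {- int m..int m})"
    by auto
  then have "(\<Sum>k\<in>{- int (Suc m)..int (Suc m)}. (1 / 2 :: real) ^ nat \<bar>k\<bar>)
      = (\<Sum>k\<in>{- int m..int m}. (1 / 2) ^ nat \<bar>k\<bar>) + 2 * (1 / 2) ^ Suc m"
    by (simp add: nat_add_distrib)
  then show ?case using Suc by simp
qed simp

text \<open>
  Cut out of a finite box, which makes finiteness immediate and lets the sum of the weights over the
  box be computed as a product.
\<close>
definition l1_lattice_ball :: "nat \<Rightarrow> nat \<Rightarrow> (nat \<Rightarrow> int) set" where
  "l1_lattice_ball n m = {z \<in> PiE {..<n} (\<lambda>_. {- int m..int m}). (\<Sum>j<n. nat \<bar>z j\<bar>) \<le> m}"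

lemma finite_l1_lattice_ball: "finite (l1_lattice_ball n m)"
  by (auto simp: l1_lattice_ball_def intro!: finite_PiE)

text \<open>
  A generating function argument: give every lattice point the weight \<open>1/2\<close> to the power of its \<open>l\<^sub>1\<close>
  norm. Points of the ball weigh at least \<open>(1/2)\<^sup>m\<close>, while the total weight factors over the
  coordinates, and each factor is at most \<open>3\<close>. This gives an exponential bound without volumes.
\<close>
lemma card_l1_lattice_ball: "real (card (l1_lattice_ball n m)) \<le> 2 ^ m * 3 ^ n"
proof -
  let ?P = "PiE {..<n} (\<lambda>_. {- int m..int m})"
  have "real (card (l1_lattice_ball n m)) = (\<Sum>z\<in>l1_lattice_ball n m. 1)"
    by simp
  also have "\<dots> \<le> (\<Sum>z\<in>l1_lattice_ball n m. 2 ^ m * (\<Prod>j<n. (1 / 2) ^ nat \<bar>z j\<bar>))"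
  proof (rule sum_mono)
    fix z assume "z \<in> l1_lattice_ball n m"
    then have "(1 / 2 :: real) ^ m \<le> (1 / 2) ^ (\<Sum>j<n. nat \<bar>z j\<bar>)"
      by (intro power_decreasing) (auto simp: l1_lattice_ball_def)
    then have "2 ^ m * (1 / 2 :: real) ^ m \<le> 2 ^ m * (\<Prod>j<n. (1 / 2) ^ nat \<bar>z j\<bar>)"
      by (simp add: power_sum)
    then show "1 \<le> 2 ^ m * (\<Prod>j<n. (1 / 2 :: real) ^ nat \<bar>z j\<bar>)"
      by (simp flip: power_mult_distrib)
  qed
  also have "\<dots> \<le> (\<Sum>z\<in>?P. 2 ^ m * (\<Prod>j<n. (1 / 2) ^ nat \<bar>z j\<bar>))"
  proof (rule sum_mono2)
    show "finite ?P" by (intro finite_PiE) auto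
    show "l1_lattice_ball n m \<subseteq> ?P" unfolding l1_lattice_ball_def by blast
  qed (intro mult_nonneg_nonneg prod_nonneg; simp)
  also have "\<dots> = 2 ^ m * (\<Prod>j<n. \<Sum>k\<in>{- int m..int m}. (1 / 2) ^ nat \<bar>k\<bar>)"
    by (subst prod_sum_PiE) (simp_all add: sum_distrib_left)
  also have "\<dots> \<le> 2 ^ m * (\<Prod>j<n. 3)"
  proof (intro mult_left_mono prod_mono conjI)
    have "(0 :: real) \<le> (1 / 2) ^ m" by simp
    then show "(\<Sum>k\<in>{- int m..int m}. (1 / 2 :: real) ^ nat \<bar>k\<bar>) \<le> 3"
      using sum_half_powers_le[of m] by linarith
  qed (auto intro: sum_nonneg)
  finally show ?thesis by simp
qed

text \<open>
  Rounding towards zero never increases an absolute value, so a rounded unit vector stays in the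
  unit ball.
\<close>
definition round_to_zero :: "real \<Rightarrow> int" where
  "round_to_zero x = (if 0 \<le> x then \<lfloor>x\<rfloor> else \<lceil>x\<rceil>)"

lemma abs_round_to_zero_le: "\<bar>real_of_int (round_to_zero x)\<bar> \<le> \<bar>x\<bar>"
proof (cases "0 \<le> x")
  case True
  then have "0 \<le> \<lfloor>x\<rfloor>" by simp
  then show ?thesis using True of_int_floor_le[of x] by (simp add: round_to_zero_def)
next
  case False
  then have "\<lceil>x\<rceil> \<le> 0" by (simp add: ceiling_le_iff)
  then show ?thesis using False le_of_int_ceiling[of x] by (simp add: round_to_zero_def)
qed

lemma abs_diff_round_to_zero_le: "\<bar>x - real_of_int (round_to_zero x)\<bar> \<le> 1"
proof -
  have "\<bar>x - real_of_int \<lfloor>x\<rfloor>\<bar> \<le> 1" using floor_correct[of x] by linarith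
  moreover have "\<bar>x - real_of_int \<lceil>x\<rceil>\<bar> \<le> 1" using ceiling_correct[of x] by linarith
  ultimately show ?thesis by (simp add: round_to_zero_def)
qed

text \<open>
  With mesh \<open>1 / (4 sqrt n)\<close>, rounding every coordinate moves a vector by at most \<open>1 / 4\<close>. The
  lattice coordinates of a rounded unit vector sum, in absolute value, to at most
  \<open>4 sqrt n\<close> times its \<open>l\<^sub>1\<close> norm, hence to at most \<open>4 n\<close>.
\<close>
definition lattice_net :: "nat \<Rightarrow> real vec set" where
  "lattice_net n = (\<lambda>z. vec n (\<lambda>j. real_of_int (z j) / (4 * sqrt (real n)))) ` l1_lattice_ball n (4 * n)
     \<inter> {w. vec_norm2 w \<le> 1}"

lemma finite_lattice_net: "finite (lattice_net n)"
  by (simp add: lattice_net_def finite_l1_lattice_ball)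

lemma card_lattice_net_le: "real (card (lattice_net n)) \<le> exp (6 * real n)"
proof -
  have "card (lattice_net n) \<le> card (l1_lattice_ball n (4 * n))"
    unfolding lattice_net_def
    by (rule order.trans[OF card_mono card_image_le]) (auto simp: finite_l1_lattice_ball)
  then have "real (card (lattice_net n)) \<le> 2 ^ (4 * n) * 3 ^ n"
    using card_l1_lattice_ball[of n "4 * n"] by linarith
  \<comment> \<open>\<open>48 = 2\<^sup>4 * 3\<close>, and \<open>48 \<le> 2\<^sup>6 \<le> e\<^sup>6\<close> gives the exponent\<close>
  also have "\<dots> = 48 ^ n" by (simp add: power_mult flip: power_mult_distrib)
  also have "\<dots> \<le> exp 6 ^ n"
  proof (intro power_mono)
    have "(2 :: real) ^ 6 \<le> exp 1 ^ 6"
      using exp_ge_add_one_self[of 1] by (intro power_mono) auto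
    then show "(48 :: real) \<le> exp 6" by (simp flip: exp_of_nat_mult)
  qed simp
  finally show ?thesis by (simp add: mult.commute flip: exp_of_nat_mult)
qed

lemma lattice_net_carrier: "w \<in> lattice_net n \<Longrightarrow> w \<in> carrier_vec n"
  by (auto simp: lattice_net_def)

lemma lattice_net_norm: "w \<in> lattice_net n \<Longrightarrow> vec_norm2 w \<le> 1"
  by (auto simp: lattice_net_def)

lemma lattice_net_approx:
  assumes v: "v \<in> carrier_vec n" and v1: "vec_norm2 v = 1"
  shows "\<exists>w\<in>lattice_net n. vec_norm2 (v - w) \<le> 1 / 4"
proof -
  let ?h = "4 * sqrt (real n)"
  have sq: "(\<Sum>j<n. (vec_index v j)\<^sup>2) = 1"
    using v v1 by (simp add: vec_norm2_eq)
  have n: "0 < n" using sq by (cases n) auto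
  have h: "0 < ?h" using n by simp
  define z where "z = (\<lambda>j\<in>{..<n}. round_to_zero (vec_index v j * ?h))"
  define w where "w = vec n (\<lambda>j. real_of_int (z j) / ?h)"
  have absz: "\<bar>real_of_int (z j)\<bar> \<le> \<bar>vec_index v j\<bar> * ?h" if "j < n" for j
    using abs_round_to_zero_le[of "vec_index v j * ?h"] that by (simp add: z_def abs_mult)
  \<comment> \<open>Cauchy--Schwarz against the constant vector\<close>
  have "(\<Sum>j<n. \<bar>vec_index v j\<bar> * 1) \<le> L2_set (\<lambda>j. \<bar>vec_index v j\<bar>) {..<n} * L2_set (\<lambda>_. 1) {..<n}"
    using L2_set_mult_ineq[of "\<lambda>j. vec_index v j" "\<lambda>_. 1" "{..<n}"]
    by (simp add: L2_set_def)
  then have l1: "(\<Sum>j<n. \<bar>vec_index v j\<bar>) \<le> sqrt (real n)"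
    using sq by (simp add: L2_set_def)
  have "(\<Sum>j<n. \<bar>real_of_int (z j)\<bar>) \<le> (\<Sum>j<n. \<bar>vec_index v j\<bar> * ?h)"
    by (intro sum_mono absz) simp
  also have "\<dots> = (\<Sum>j<n. \<bar>vec_index v j\<bar>) * ?h" by (simp only: sum_distrib_right)
  also have "\<dots> \<le> sqrt (real n) * ?h" using l1 h by (intro mult_right_mono) auto
  also have "\<dots> = real (4 * n)" by simp
  finally have "(\<Sum>j<n. \<bar>real_of_int (z j)\<bar>) \<le> real (4 * n)" .
  moreover have "(\<Sum>j<n. \<bar>real_of_int (z j)\<bar>) = real (\<Sum>j<n. nat \<bar>z j\<bar>)" by simp
  ultimately have sumz: "(\<Sum>j<n. nat \<bar>z j\<bar>) \<le> 4 * n" by linarith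
  have "z j \<in> {- int (4 * n)..int (4 * n)}" if "j < n" for j
  proof -
    have "nat \<bar>z j\<bar> \<le> (\<Sum>j<n. nat \<bar>z j\<bar>)" using that by (intro member_le_sum) auto
    then have "\<bar>z j\<bar> \<le> int (4 * n)" using sumz by linarith
    then show ?thesis by (simp add: abs_le_iff)
  qed
  then have "z \<in> PiE {..<n} (\<lambda>_. {- int (4 * n)..int (4 * n)})"
    by (intro PiE_I) (simp_all add: z_def)
  then have "z \<in> l1_lattice_ball n (4 * n)"
    using sumz unfolding l1_lattice_ball_def by blast
  moreover have "vec_norm2 w \<le> 1"
  proof -
    have "(\<Sum>j<n. (vec_index w j)\<^sup>2) \<le> (\<Sum>j<n. (vec_index v j)\<^sup>2)"
    proof (rule sum_mono)
      fix j assume "j \<in> {..<n}"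
      then have "\<bar>vec_index w j\<bar> \<le> \<bar>vec_index v j\<bar>"
        using absz[of j] h by (simp add: w_def divide_le_eq)
      then show "(vec_index w j)\<^sup>2 \<le> (vec_index v j)\<^sup>2" by (simp add: abs_le_square_iff)
    qed
    then show ?thesis using sq by (simp add: vec_norm2_eq w_def)
  qed
  ultimately have "w \<in> lattice_net n" by (auto simp: lattice_net_def w_def)
  moreover have "vec_norm2 (v - w) \<le> 1 / 4"
  proof -
    have "(\<Sum>j<n. (vec_index (v - w) j)\<^sup>2) \<le> (\<Sum>j<n. (1 / ?h)\<^sup>2)"
    proof (rule sum_mono)
      fix j assume j: "j \<in> {..<n}"
      have "vec_index (v - w) j = (vec_index v j * ?h - real_of_int (z j)) / ?h"
        using j n v by (simp add: w_def diff_divide_distrib)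
      then have "\<bar>vec_index (v - w) j\<bar> \<le> \<bar>1 / ?h\<bar>"
        using abs_diff_round_to_zero_le[of "vec_index v j * ?h"] j h
        by (simp add: z_def divide_right_mono)
      then show "(vec_index (v - w) j)\<^sup>2 \<le> (1 / ?h)\<^sup>2" by (simp only: abs_le_square_iff)
    qed
    also have "\<dots> = (1 / 4)\<^sup>2" using n by (simp add: power2_eq_square)
    finally have "vec_norm2 (v - w) \<le> sqrt ((1 / 4)\<^sup>2)"
      unfolding vec_norm2_eq by (intro real_sqrt_le_mono) (simp add: w_def)
    then show ?thesis by simp
  qed
  ultimately show ?thesis by blast
qed

section \<open>Tails of noncentral chi-squared variables\<close>

text \<open>
  Completing the square: tilting a normal density by a quadratic exponential yields, up to a
  constant, the normal density of variance \<open>1 / (1 - 2 s)\<close>.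
\<close>
lemma exp_square_times_std_normal_density:
  assumes s: "s \<le> 1 / 4"
  shows "exp (s * ((a + x)\<^sup>2 - 1 - a\<^sup>2)) * std_normal_density x =
    exp (2 * s\<^sup>2 * a\<^sup>2 / (1 - 2 * s) - s) / sqrt (1 - 2 * s)
      * normal_density (2 * s * a / (1 - 2 * s)) (1 / sqrt (1 - 2 * s)) x"
proof -
  let ?k = "1 - 2 * s"
  have k: "0 < ?k" using s by simp
  have "s * ((a + x)\<^sup>2 - 1 - a\<^sup>2) + - x\<^sup>2 / 2
      = 2 * s\<^sup>2 * a\<^sup>2 / ?k - s + - (x - 2 * s * a / ?k)\<^sup>2 / (2 * (1 / sqrt ?k)\<^sup>2)"
  proof -
    have "(x - 2 * s * a / ?k)\<^sup>2 = (?k * x - 2 * s * a)\<^sup>2 / ?k\<^sup>2"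
      using k by (simp add: diff_divide_distrib flip: power_divide)
    then have e: "- (x - 2 * s * a / ?k)\<^sup>2 / (2 * (1 / sqrt ?k)\<^sup>2) = - (?k * x - 2 * s * a)\<^sup>2 / (2 * ?k)"
      using k by (simp add: power_divide power2_eq_square[of ?k])
    show ?thesis unfolding e using k
      by (simp add: divide_simps) (simp add: algebra_simps power2_eq_square)
  qed
  then have "exp (s * ((a + x)\<^sup>2 - 1 - a\<^sup>2)) * exp (- x\<^sup>2 / 2)
      = exp (2 * s\<^sup>2 * a\<^sup>2 / ?k - s) * exp (- (x - 2 * s * a / ?k)\<^sup>2 / (2 * (1 / sqrt ?k)\<^sup>2))"
    by (simp only: flip: exp_add)
  then show ?thesis
    using k by (simp add: normal_density_def power_divide real_sqrt_divide real_sqrt_mult)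
qed

lemma inverse_sqrt_le_exp:
  fixes s :: real
  assumes "\<bar>s\<bar> \<le> 1 / 4"
  shows "1 / sqrt (1 - 2 * s) \<le> exp (s + 4 * s\<^sup>2)"
proof -
  have pos: "0 < 1 - 2 * s" using assms by linarith
  have "- (2 * s) - 2 * (2 * s)\<^sup>2 \<le> ln (1 - 2 * s)"
  proof (cases "0 \<le> s")
    case True
    then show ?thesis using ln_one_minus_pos_lower_bound[of "2 * s"] assms by simp
  next
    case False
    then have "- (2 * s) - (2 * s)\<^sup>2 \<le> ln (1 - 2 * s)"
      using ln_one_plus_pos_lower_bound[of "- 2 * s"] assms by simp
    then show ?thesis using zero_le_power2[of "2 * s"] by linarith
  qed
  then have "exp (- (2 * s) - 2 * (2 * s)\<^sup>2) \<le> 1 - 2 * s" using pos by (simp add: ln_ge_iff)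
  then have "sqrt (exp (- (2 * s) - 2 * (2 * s)\<^sup>2)) \<le> sqrt (1 - 2 * s)" by (rule real_sqrt_le_mono)
  also have "sqrt (exp (- (2 * s) - 2 * (2 * s)\<^sup>2)) = exp (- (s + 4 * s\<^sup>2))"
    by (rule real_sqrt_unique) (simp_all add: power2_eq_square algebra_simps flip: exp_add)
  finally have "exp (- (s + 4 * s\<^sup>2)) \<le> sqrt (1 - 2 * s)" .
  then have "1 / sqrt (1 - 2 * s) \<le> 1 / exp (- (s + 4 * s\<^sup>2))"
    using pos by (intro divide_left_mono) auto
  then show ?thesis by (simp only: exp_minus inverse_eq_divide divide_divide_eq_right mult_1)
qed

text \<open>
  The moment generating function of the centered square of a normal variable with mean \<open>a\<close> is
  bounded by that of a Gaussian for small \<open>s\<close>. The tilted density has total mass one, so only its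
  constant matters.
\<close>
lemma nn_integral_exp_centered_square_le:
  assumes s: "\<bar>s\<bar> \<le> 1 / 4"
  shows "(\<integral>\<^sup>+x. ennreal (std_normal_density x) * ennreal (exp (s * ((a + x)\<^sup>2 - 1 - a\<^sup>2))) \<partial>lborel)
     \<le> ennreal (exp (4 * s\<^sup>2 * (1 + a\<^sup>2)))"
proof -
  let ?k = "1 - 2 * s"
  let ?C = "exp (2 * s\<^sup>2 * a\<^sup>2 / ?k - s) / sqrt ?k"
  let ?d = "normal_density (2 * s * a / ?k) (1 / sqrt ?k)"
  have k: "0 < ?k" "1 / 2 \<le> ?k" using s by linarith+
  have "(\<integral>\<^sup>+x. ennreal (std_normal_density x) * ennreal (exp (s * ((a + x)\<^sup>2 - 1 - a\<^sup>2))) \<partial>lborel)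
      = (\<integral>\<^sup>+x. ennreal ?C * ennreal (?d x) \<partial>lborel)"
    using exp_square_times_std_normal_density[of s a] s
    by (intro nn_integral_cong) (simp add: normal_density_nonneg mult.commute flip: ennreal_mult)
  also have "\<dots> = ennreal ?C * (\<integral>\<^sup>+x. ennreal (?d x) \<partial>lborel)"
    by (rule nn_integral_cmult) simp
  also have "(\<integral>\<^sup>+x. ennreal (?d x) \<partial>lborel) = 1"
    using k by (subst nn_integral_eq_integral) (simp_all add: normal_density_nonneg)
  also have "ennreal ?C * 1 \<le> ennreal (exp (4 * s\<^sup>2 * (1 + a\<^sup>2)))"
  proof -
    have "?C = exp (2 * s\<^sup>2 * a\<^sup>2 / ?k - s) * (1 / sqrt ?k)" by simp
    also have "\<dots> \<le> exp (2 * s\<^sup>2 * a\<^sup>2 / ?k - s) * exp (s + 4 * s\<^sup>2)"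
      by (intro mult_left_mono inverse_sqrt_le_exp s) simp
    also have "\<dots> = exp (2 * s\<^sup>2 * a\<^sup>2 / ?k + 4 * s\<^sup>2)" by (simp flip: exp_add)
    also have "\<dots> \<le> exp (4 * s\<^sup>2 * (1 + a\<^sup>2))"
    proof -
      have "2 * s\<^sup>2 * a\<^sup>2 / ?k \<le> 2 * s\<^sup>2 * a\<^sup>2 / (1 / 2)"
        using k by (intro divide_left_mono) auto
      moreover have "0 \<le> s\<^sup>2" by simp
      ultimately show ?thesis by (simp add: algebra_simps)
    qed
    finally show ?thesis by (simp add: ennreal_leI)
  qed
  finally show ?thesis .
qed

text \<open>
  The noise enters twice: through all its entries, for the trace, and through the coordinates of
  its product with a unit vector, for the quadratic form. Both families are instances of this
  locale and share one tail bound.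
\<close>
locale iid_std_normal = prob_space +
  fixes g :: "'i \<Rightarrow> 'a \<Rightarrow> real" and I :: "'i set"
  assumes fin: "finite I"
    and indep: "indep_vars (\<lambda>_. borel) g I"
    and std: "\<And>i. i \<in> I \<Longrightarrow> distributed M lborel (g i) std_normal_density"
begin

lemma g_measurable [measurable]: "i \<in> I \<Longrightarrow> g i \<in> borel_measurable M"
  using indep by (auto simp: indep_vars_def)

text \<open>
  A noncentral chi-squared variable minus its expectation.
\<close>
definition centered_sum :: "('i \<Rightarrow> real) \<Rightarrow> 'a \<Rightarrow> real" where
  "centered_sum a \<omega> = (\<Sum>i\<in>I. (a i + g i \<omega>)\<^sup>2) - real (card I) - (\<Sum>i\<in>I. (a i)\<^sup>2)"

lemma centered_sum_measurable [measurable]: "centered_sum a \<in> borel_measurable M"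
  unfolding centered_sum_def by measurable

lemma mgf_centered_sum_le:
  assumes s: "\<bar>s\<bar> \<le> 1 / 4"
  shows "(\<integral>\<^sup>+\<omega>. ennreal (exp (s * centered_sum a \<omega>)) \<partial>M)
     \<le> ennreal (exp (4 * s\<^sup>2 * (real (card I) + (\<Sum>i\<in>I. (a i)\<^sup>2))))"
proof -
  define f where "f i x = exp (s * ((a i + x)\<^sup>2 - 1 - (a i)\<^sup>2))" for i x
  have f [measurable]: "f i \<in> borel_measurable borel" for i
    unfolding f_def by measurable
  have "exp (s * centered_sum a \<omega>) = (\<Prod>i\<in>I. f i (g i \<omega>))" for \<omega>
    using fin by (simp add: f_def centered_sum_def sum_subtractf flip: exp_sum sum_distrib_left)
  then have "(\<integral>\<^sup>+\<omega>. ennreal (exp (s * centered_sum a \<omega>)) \<partial>M)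
      = (\<integral>\<^sup>+\<omega>. (\<Prod>i\<in>I. ennreal (f i (g i \<omega>))) \<partial>M)"
    by (simp add: f_def prod_ennreal)
  also have "\<dots> = (\<Prod>i\<in>I. \<integral>\<^sup>+\<omega>. ennreal (f i (g i \<omega>)) \<partial>M)"
  proof (rule indep_vars_nn_integral[OF fin])
    show "indep_vars (\<lambda>_. borel) (\<lambda>i \<omega>. ennreal (f i (g i \<omega>))) I"
      by (rule indep_vars_compose2[OF indep]) measurable
  qed simp
  also have "\<dots> \<le> (\<Prod>i\<in>I. ennreal (exp (4 * s\<^sup>2 * (1 + (a i)\<^sup>2))))"
  proof (rule prod_mono_ennreal)
    fix i assume "i \<in> I"
    then have "(\<integral>\<^sup>+\<omega>. ennreal (f i (g i \<omega>)) \<partial>M)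
        = (\<integral>\<^sup>+x. ennreal (std_normal_density x) * ennreal (f i x) \<partial>lborel)"
      by (subst distributed_nn_integral[OF std]) auto
    also have "\<dots> \<le> ennreal (exp (4 * s\<^sup>2 * (1 + (a i)\<^sup>2)))"
      unfolding f_def by (rule nn_integral_exp_centered_square_le[OF s])
    finally show "(\<integral>\<^sup>+\<omega>. ennreal (f i (g i \<omega>)) \<partial>M) \<le> ennreal (exp (4 * s\<^sup>2 * (1 + (a i)\<^sup>2)))" .
  qed
  also have "\<dots> = ennreal (exp (4 * s\<^sup>2 * (real (card I) + (\<Sum>i\<in>I. (a i)\<^sup>2))))"
    using fin by (simp add: prod_ennreal sum.distrib flip: exp_sum sum_distrib_left)
  finally show ?thesis .
qed

text \<open>
  Chernoff's bound with the sub-Gaussian moment generating function, which is available only for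
  exponents at most \<open>1 / 4\<close>. The optimal exponent \<open>sqrt (t / V) / 2\<close> is truncated there; this
  produces the linear term \<open>8 * t\<close>.
\<close>
lemma centered_sum_one_sided_tail:
  assumes t: "0 < t" and V: "real (card I) + (\<Sum>i\<in>I. (a i)\<^sup>2) \<le> V" and e: "e = 1 \<or> e = - 1"
  shows "prob {\<omega> \<in> space M. 4 * sqrt (t * V) + 8 * t < e * centered_sum a \<omega>} \<le> exp (- t)"
proof -
  let ?x = "4 * sqrt (t * V) + 8 * t"
  let ?V = "real (card I) + (\<Sum>i\<in>I. (a i)\<^sup>2)"
  have V0: "0 \<le> ?V" by (simp add: sum_nonneg)
  obtain r where r: "0 < r" "r \<le> 1 / 4" "4 * r\<^sup>2 * V \<le> t" "2 * t \<le> r * ?x"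
  proof (cases "4 * t \<le> V")
    case True
    let ?r = "sqrt (t / V) / 2"
    have Vp: "0 < V" using True t by linarith
    have "sqrt (t / V) \<le> sqrt ((1 / 2)\<^sup>2)"
      using True Vp by (intro real_sqrt_le_mono) (simp add: field_simps power2_eq_square)
    then have "?r \<le> 1 / 4" by simp
    moreover have "4 * ?r\<^sup>2 * V = t" using t Vp by (simp add: power_divide)
    moreover have "?r * (4 * sqrt (t * V)) = 2 * t"
      using t Vp by (simp add: real_sqrt_divide real_sqrt_mult)
    moreover have "0 < ?r" using t Vp by simp
    ultimately show ?thesis using t by (intro that[of ?r]) (auto simp: distrib_left)
  next
    case False
    moreover have "0 \<le> sqrt (t * V)" using t V V0 by simp
    ultimately show ?thesis using t by (intro that[of "1 / 4"]) (auto simp: power2_eq_square)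
  qed
  have s: "\<bar>r * e\<bar> \<le> 1 / 4" and s2: "(r * e)\<^sup>2 = r\<^sup>2" using e r by auto
  let ?A = "{\<omega> \<in> space M. ?x < e * centered_sum a \<omega>}"
  have "emeasure M ?A \<le> emeasure M {\<omega> \<in> space M. 1 \<le> ennreal (exp (- r * ?x)) * ennreal (exp ((r * e) * centered_sum a \<omega>))}"
  proof (rule emeasure_mono)
    show "?A \<subseteq> {\<omega> \<in> space M. 1 \<le> ennreal (exp (- r * ?x)) * ennreal (exp ((r * e) * centered_sum a \<omega>))}"
    proof safe
      fix \<omega> assume "?x < e * centered_sum a \<omega>"
      then have "r * ?x \<le> r * (e * centered_sum a \<omega>)" using r by (intro mult_left_mono) auto
      then have "1 \<le> exp (- r * ?x + (r * e) * centered_sum a \<omega>)" by (simp add: mult.assoc)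
      then have "ennreal 1 \<le> ennreal (exp (- r * ?x) * exp ((r * e) * centered_sum a \<omega>))"
        unfolding exp_add by (rule ennreal_leI)
      then show "1 \<le> ennreal (exp (- r * ?x)) * ennreal (exp ((r * e) * centered_sum a \<omega>))"
        by (simp only: ennreal_1 ennreal_mult exp_ge_zero)
    qed
  qed measurable
  also have "\<dots> \<le> ennreal (exp (- r * ?x)) * (\<integral>\<^sup>+\<omega>. ennreal (exp ((r * e) * centered_sum a \<omega>)) * indicator (space M) \<omega> \<partial>M)"
    by (rule nn_integral_Markov_inequality) measurable
  also have "\<dots> = ennreal (exp (- r * ?x)) * (\<integral>\<^sup>+\<omega>. ennreal (exp ((r * e) * centered_sum a \<omega>)) \<partial>M)"
    by (intro arg_cong2[where f="(*)"] refl nn_integral_cong) simp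
  also have "\<dots> \<le> ennreal (exp (- r * ?x)) * ennreal (exp (4 * (r * e)\<^sup>2 * ?V))"
    by (intro mult_left_mono mgf_centered_sum_le s) simp
  also have "\<dots> = ennreal (exp (4 * r\<^sup>2 * ?V - r * ?x))"
    by (simp add: s2 add.commute flip: ennreal_mult exp_add)
  also have "\<dots> \<le> ennreal (exp (- t))"
  proof -
    have "4 * r\<^sup>2 * ?V \<le> 4 * r\<^sup>2 * V" using V by (intro mult_left_mono) auto
    then have "4 * r\<^sup>2 * ?V - r * ?x \<le> - t" using r by linarith
    then show ?thesis by (intro ennreal_leI) simp
  qed
  finally show ?thesis by (simp add: emeasure_eq_measure)
qed

lemma centered_sum_tail:
  assumes t: "0 < t" and V: "real (card I) + (\<Sum>i\<in>I. (a i)\<^sup>2) \<le> V"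
  shows "prob {\<omega> \<in> space M. 4 * sqrt (t * V) + 8 * t < \<bar>centered_sum a \<omega>\<bar>} \<le> 2 * exp (- t)"
proof -
  let ?x = "4 * sqrt (t * V) + 8 * t"
  let ?A = "\<lambda>e. {\<omega> \<in> space M. ?x < e * centered_sum a \<omega>}"
  have split: "{\<omega> \<in> space M. ?x < \<bar>centered_sum a \<omega>\<bar>} = ?A 1 \<union> ?A (- 1)"
    by (auto simp: abs_if split: if_splits)
  have "prob (?A 1 \<union> ?A (- 1)) \<le> prob (?A 1) + prob (?A (- 1))"
    by (rule measure_Un_le) measurable
  moreover have "prob (?A 1) \<le> exp (- t)"
    by (rule centered_sum_one_sided_tail[OF t V]) simp
  moreover have "prob (?A (- 1)) \<le> exp (- t)"
    by (rule centered_sum_one_sided_tail[OF t V]) simp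
  ultimately show ?thesis unfolding split by linarith
qed

end

section \<open>The Gaussian matrix\<close>

context iid_std_normal begin

text \<open>
  Combinations over disjoint index sets are independent, and each of them is normal with variance
  the sum of the squared weights. The coordinates of the noise matrix times a unit vector are of this
  kind, since distinct rows have disjoint index sets.
\<close>
lemma orthonormal_combinations:
  assumes L: "finite L" and K: "\<And>l. l \<in> L \<Longrightarrow> K l \<subseteq> I" and disj: "disjoint_family_on K L"
    and unit: "\<And>l. l \<in> L \<Longrightarrow> (\<Sum>k\<in>K l. (c k)\<^sup>2) = 1"
  shows "iid_std_normal M (\<lambda>l \<omega>. \<Sum>k\<in>K l. c k * g k \<omega>) L"
proof
  show "finite L" by fact
  have "indep_vars (\<lambda>l. PiM (K l) (\<lambda>_. borel)) (\<lambda>l \<omega>. restrict (\<lambda>k. g k \<omega>) (K l)) L"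
    by (rule indep_vars_restrict[OF indep K disj])
  then have "indep_vars (\<lambda>_. borel) (\<lambda>l \<omega>. (\<lambda>x. \<Sum>k\<in>K l. c k * x k) (restrict (\<lambda>k. g k \<omega>) (K l))) L"
    by (rule indep_vars_compose2) measurable
  then show "indep_vars (\<lambda>_. borel) (\<lambda>l \<omega>. \<Sum>k\<in>K l. c k * g k \<omega>) L"
    by (simp cong: sum.cong)
next
  fix l assume l: "l \<in> L"
  \<comment> \<open>the sum rule for normal variables requires positive variances, so zero weights are left out\<close>
  let ?J = "{k \<in> K l. c k \<noteq> 0}"
  have finK: "finite (K l)" using K[OF l] fin by (rule finite_subset)
  have sumJ: "(\<Sum>k\<in>?J. f k) = (\<Sum>k\<in>K l. f k)" if "\<And>k. c k = 0 \<Longrightarrow> f k = 0" for f :: "'i \<Rightarrow> real"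
    using finK that by (intro sum.mono_neutral_left) auto
  have ne: "?J \<noteq> {}"
  proof
    assume empty: "?J = {}"
    have "(\<Sum>k\<in>?J. (c k)\<^sup>2) = 1" using unit[OF l] by (subst sumJ) auto
    then show False unfolding empty by simp
  qed
  have "distributed M lborel (\<lambda>\<omega>. \<Sum>k\<in>?J. c k * g k \<omega>)
      (normal_density (\<Sum>k\<in>?J. 0) (sqrt (\<Sum>k\<in>?J. \<bar>c k\<bar>\<^sup>2)))"
  proof (rule sum_indep_normal)
    show "finite ?J" using finK by simp
    show "indep_vars (\<lambda>_. borel) (\<lambda>k \<omega>. c k * g k \<omega>) ?J"
      using K[OF l] by (intro indep_vars_compose2[OF indep_vars_subset[OF indep]]) auto
  next
    fix k assume k: "k \<in> ?J"
    then show "0 < \<bar>c k\<bar>" by simp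
    show "distributed M lborel (\<lambda>\<omega>. c k * g k \<omega>) (normal_density 0 \<bar>c k\<bar>)"
      using normal_density_affine[OF std, of k "c k" 0] k K[OF l] by auto
  qed (rule ne)
  moreover have "(\<Sum>k\<in>?J. \<bar>c k\<bar>\<^sup>2) = 1" using unit[OF l] by (subst sumJ) auto
  moreover have "(\<lambda>\<omega>. \<Sum>k\<in>?J. c k * g k \<omega>) = (\<lambda>\<omega>. \<Sum>k\<in>K l. c k * g k \<omega>)"
    by (intro ext sumJ) simp
  ultimately show "distributed M lborel (\<lambda>\<omega>. \<Sum>k\<in>K l. c k * g k \<omega>) std_normal_density"
    by simp
qed

end

lemma prob_space_std_normal_entries: "prob_space (std_normal_entries p q)"
  unfolding std_normal_entries_def by (intro prob_space_PiM prob_space_normal_density) simp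

lemma space_std_normal_entries: "space (std_normal_entries p q) = PiE ({..<p} \<times> {..<q}) (\<lambda>_. UNIV)"
  by (simp add: std_normal_entries_def space_PiM)

lemma std_normal_entries_coordinate_measurable:
  assumes "k \<in> {..<p} \<times> {..<q}"
  shows "(\<lambda>E. E k) \<in> borel_measurable (std_normal_entries p q)"
proof -
  let ?N = "density lborel (\<lambda>x. ennreal (std_normal_density x))"
  have "(\<lambda>E. E k) \<in> measurable (std_normal_entries p q) ?N"
    unfolding std_normal_entries_def by (rule measurable_component_singleton[OF assms])
  moreover have "sets ?N = sets borel" by simp
  ultimately show ?thesis using measurable_cong_sets by blast
qed

lemma iid_std_normal_entries:
  assumes "0 < p" "0 < q"
  shows "iid_std_normal (std_normal_entries p q) (\<lambda>k E. E k) ({..<p} \<times> {..<q})"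
proof -
  let ?I = "{..<p} \<times> {..<q}" and ?P = "std_normal_entries p q"
  let ?N = "density lborel (\<lambda>x. ennreal (std_normal_density x))"
  interpret prob_space ?P by (rule prob_space_std_normal_entries)
  have law: "distr ?P borel (\<lambda>E. E k) = ?N" if "k \<in> ?I" for k
  proof -
    have "distr ?P borel (\<lambda>E. E k) = distr ?P ?N (\<lambda>E. E k)"
      by (rule distr_cong) auto
    also have "\<dots> = ?N"
      unfolding std_normal_entries_def
      using that by (intro distr_PiM_component prob_space_normal_density) auto
    finally show ?thesis .
  qed
  have "distr ?P (PiM ?I (\<lambda>_. borel)) (\<lambda>E. \<lambda>k\<in>?I. E k) = distr ?P ?P (\<lambda>E. E)"
  proof (rule distr_cong)
    show "sets (PiM ?I (\<lambda>_. borel)) = sets ?P"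
      unfolding std_normal_entries_def by (intro sets_PiM_cong) auto
  qed (auto simp: space_std_normal_entries PiE_def extensional_restrict)
  also have "\<dots> = PiM ?I (\<lambda>k. distr ?P borel (\<lambda>E. E k))"
    by (simp add: distr_id2 law cong: PiM_cong) (simp add: std_normal_entries_def)
  finally have "indep_vars (\<lambda>_. borel) (\<lambda>k E. E k) ?I"
    using assms by (subst indep_vars_iff_distr_eq_PiM')
      (auto simp: lessThan_empty_iff std_normal_entries_coordinate_measurable)
  moreover have "distributed ?P lborel (\<lambda>E. E k) std_normal_density" if "k \<in> ?I" for k
  proof -
    have "distr ?P lborel (\<lambda>E. E k) = distr ?P borel (\<lambda>E. E k)"
      by (rule distr_cong) auto
    then show ?thesis
      using law[OF that] std_normal_entries_coordinate_measurable[OF that]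
      by (simp add: distributed_def)
  qed
  ultimately show ?thesis by unfold_locales auto
qed

section \<open>The centered Gram matrix and measurability\<close>

lemma centered_gram_carrier: "Y \<in> carrier_mat p q \<Longrightarrow> centered_gram Y \<in> carrier_mat q q"
  by (auto simp: centered_gram_def)

lemma transpose_gram:
  fixes B :: "real mat"
  assumes B: "B \<in> carrier_mat p q"
  shows "transpose_mat (transpose_mat B * B) = transpose_mat B * B"
  using transpose_mult[of "transpose_mat B" q p B q] B by simp

lemma transpose_centered_gram:
  assumes Y: "Y \<in> carrier_mat p q"
  shows "transpose_mat (centered_gram Y) = centered_gram Y"
proof -
  have "transpose_mat (smult_mat (real p) (one_mat q)) = smult_mat (real p) (one_mat q :: real mat)"
    by (intro eq_matI) auto
  then show ?thesis
    using Y transpose_gram[OF Y]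
    by (simp add: centered_gram_def transpose_minus[of _ q q])
qed

lemma gram_quadratic_form:
  fixes B :: "real mat"
  assumes B: "B \<in> carrier_mat p q" and w: "w \<in> carrier_vec q"
  shows "scalar_prod w (mult_mat_vec (transpose_mat B * B) w) = (vec_norm2 (mult_mat_vec B w))\<^sup>2"
proof -
  have Bw: "mult_mat_vec B w \<in> carrier_vec p" using B w by auto
  have "scalar_prod w (mult_mat_vec (transpose_mat B * B) w)
      = scalar_prod w (mult_mat_vec (transpose_mat B) (mult_mat_vec B w))"
    using assoc_mult_mat_vec[of "transpose_mat B" q p B q w] B w by simp
  also have "\<dots> = scalar_prod (mult_mat_vec (transpose_mat B) (mult_mat_vec B w)) w"
    using B w Bw by (intro comm_scalar_prod[of _ q]) auto
  also have "\<dots> = (vec_norm2 (mult_mat_vec B w))\<^sup>2"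
    using transpose_vec_mult_scalar[OF B w Bw] by (simp add: vec_norm2_square)
  finally show ?thesis .
qed

lemma centered_gram_quadratic_form:
  assumes Y: "Y \<in> carrier_mat p q" and w: "w \<in> carrier_vec q"
  shows "scalar_prod w (mult_mat_vec (centered_gram Y) w)
     = (vec_norm2 (mult_mat_vec Y w))\<^sup>2 - real p * scalar_prod w w"
proof -
  have "mult_mat_vec (smult_mat (real p) (one_mat q)) w = smult_vec (real p) w"
    using w by (intro eq_vecI) (auto simp: smult_scalar_prod_distrib[of _ q])
  then have "mult_mat_vec (centered_gram Y) w
      = mult_mat_vec (transpose_mat Y * Y) w - smult_vec (real p) w"
    using Y w by (simp add: centered_gram_def minus_mult_distrib_mat_vec[of _ q q])
  then show ?thesis
    using gram_quadratic_form[OF Y w] Y w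
    by (simp add: scalar_prod_minus_distrib[of _ q])
qed

lemma mat_trace_centered_gram:
  assumes Y: "Y \<in> carrier_mat p q"
  shows "mat_trace (centered_gram Y) = (\<Sum>(i, j)\<in>{..<p} \<times> {..<q}. (Y $$ (i, j))\<^sup>2) - real (p * q)"
proof -
  have "mat_trace (centered_gram Y) = (\<Sum>j<q. (\<Sum>i<p. (Y $$ (i, j))\<^sup>2) - real p)"
    using Y by (simp add: mat_trace_def centered_gram_def scalar_prod_def atLeast0LessThan power2_eq_square)
  also have "\<dots> = (\<Sum>j<q. \<Sum>i<p. (Y $$ (i, j))\<^sup>2) - real (p * q)"
    by (simp add: sum_subtractf mult.commute)
  also have "(\<Sum>j<q. \<Sum>i<p. (Y $$ (i, j))\<^sup>2) = (\<Sum>(i, j)\<in>{..<p} \<times> {..<q}. (Y $$ (i, j))\<^sup>2)"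
    by (subst sum.swap) (simp add: sum.cartesian_product)
  finally show ?thesis .
qed

lemma frobenius_norm_square:
  assumes "A \<in> carrier_mat p q"
  shows "(frobenius_norm A)\<^sup>2 = (\<Sum>(i, j)\<in>{..<p} \<times> {..<q}. (A $$ (i, j))\<^sup>2)"
  using assms by (simp add: frobenius_norm_def sum_nonneg sum.cartesian_product)

text \<open>
  The supremum is taken over a countable set, which makes the operator norm of a random matrix
  measurable. If \<open>S\<close> is this supremum, then \<open>|A w| \<le> S |w|\<close> for rational \<open>w\<close>; both sides are continuous
  in \<open>w\<close> and rational vectors are dense, so the inequality holds for all \<open>w\<close>.
\<close>
lemma operator_norm_eq_SUP_rational:
  fixes A :: "real mat"
  assumes A: "A \<in> carrier_mat m n"
  shows "operator_norm A =
    (SUP w\<in>{w \<in> carrier_vec n. \<forall>j<n. vec_index w j \<in> \<rat>}. vec_norm2 (mult_mat_vec A w) / vec_norm2 w)"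
    (is "_ = (SUP w\<in>?D. ?q w)")
proof (rule antisym)
  have ne: "?D \<noteq> {}" using zero_carrier_vec[of n] by (auto intro!: exI[of _ "zero_vec n"])
  have sub: "?D \<subseteq> carrier_vec (dim_col A)" using A by auto
  have bdd: "bdd_above (?q ` ?D)"
    by (rule bdd_above_mono[OF bdd_above_operator_norm image_mono[OF sub]])
  show "(SUP w\<in>?D. ?q w) \<le> operator_norm A"
    unfolding operator_norm_def by (rule cSUP_subset_mono[OF ne bdd_above_operator_norm sub]) simp
  let ?S = "SUP w\<in>?D. ?q w"
  have D: "vec_norm2 (mult_mat_vec A w) \<le> ?S * vec_norm2 w" if w: "w \<in> ?D" for w
  proof (cases "vec_norm2 w = 0")
    case True
    then show ?thesis using vec_norm2_mult_le[of w A] w A by auto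
  next
    case False
    then have "0 < vec_norm2 w" using vec_norm2_nonneg[of w] by linarith
    then show ?thesis using cSUP_upper[OF w bdd] by (simp add: divide_le_eq)
  qed
  show "operator_norm A \<le> ?S"
  proof (rule operator_norm_le)
    have "zero_vec n \<in> ?D" by auto
    from cSUP_upper[OF this bdd] show "0 \<le> ?S" by (simp add: vec_norm2_eq)
  next
    fix v :: "real vec" assume "v \<in> carrier_vec (dim_col A)"
    then have v: "v \<in> carrier_vec n" using A by auto
    have "\<exists>r\<in>\<rat>. \<bar>r - vec_index v j\<bar> \<le> inverse (real (Suc k))" for j k
    proof -
      have "vec_index v j < vec_index v j + inverse (real (Suc k))" by simp
      then obtain r where "r \<in> \<rat>" "vec_index v j < r" "r < vec_index v j + inverse (real (Suc k))"
        using Rats_dense_in_real by blast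
      then show ?thesis by (intro bexI[of _ r]) auto
    qed
    then obtain r where r: "\<And>j k. r j k \<in> \<rat>" "\<And>j k. \<bar>r j k - vec_index v j\<bar> \<le> inverse (real (Suc k))"
      by metis
    have lim: "(\<lambda>k. r j k) \<longlonglongrightarrow> vec_index v j" for j
    proof (rule Lim_transform2[OF tendsto_const])
      have "(\<lambda>k. r j k - vec_index v j) \<longlonglongrightarrow> 0"
        by (rule Lim_null_comparison[OF _ LIMSEQ_inverse_real_of_nat]) (use r in auto)
      from tendsto_minus[OF this] show "(\<lambda>k. vec_index v j - r j k) \<longlonglongrightarrow> 0" by simp
    qed
    define w where "w k = Matrix.vec n (\<lambda>j. r j k)" for k
    have wD: "w k \<in> ?D" for k using r by (auto simp: w_def)
    have "(\<lambda>k. vec_norm2 (w k)) \<longlonglongrightarrow> vec_norm2 v"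
      using v unfolding vec_norm2_eq by (auto simp: w_def intro!: tendsto_intros lim)
    moreover have "(\<lambda>k. vec_norm2 (mult_mat_vec A (w k))) \<longlonglongrightarrow> vec_norm2 (mult_mat_vec A v)"
      using v A unfolding vec_norm2_eq
      by (auto simp: w_def scalar_prod_def intro!: tendsto_intros lim)
    ultimately show "vec_norm2 (mult_mat_vec A v) \<le> ?S * vec_norm2 v"
      using D[OF wD] by (intro LIMSEQ_le[OF _ tendsto_mult_left]) auto
  qed
qed

lemma countable_rational_vecs: "countable {w \<in> carrier_vec n. \<forall>j<n. vec_index w j \<in> (\<rat> :: real set)}"
proof (rule countable_subset)
  show "{w \<in> carrier_vec n. \<forall>j<n. vec_index w j \<in> (\<rat> :: real set)} \<subseteq> Matrix.vec n ` PiE {..<n} (\<lambda>_. \<rat>)"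
  proof
    fix w :: "real vec" assume w: "w \<in> {w \<in> carrier_vec n. \<forall>j<n. vec_index w j \<in> \<rat>}"
    then have "w = Matrix.vec n (\<lambda>j\<in>{..<n}. vec_index w j)" by (intro eq_vecI) auto
    moreover have "restrict (vec_index w) {..<n} \<in> PiE {..<n} (\<lambda>_. \<rat>)"
      using w by (intro PiE_I) auto
    ultimately show "w \<in> Matrix.vec n ` PiE {..<n} (\<lambda>_. \<rat>)" by (rule image_eqI)
  qed
  show "countable (Matrix.vec n ` PiE {..<n} (\<lambda>_. \<rat> :: real set))"
    by (intro countable_image countable_PiE countable_rat) simp
qed

lemma operator_norm_measurable:
  assumes carrier: "\<And>\<omega>. B \<omega> \<in> carrier_mat m n"
    and entries: "\<And>i j. i < m \<Longrightarrow> j < n \<Longrightarrow> (\<lambda>\<omega>. B \<omega> $$ (i, j)) \<in> borel_measurable M"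
  shows "(\<lambda>\<omega>. operator_norm (B \<omega>)) \<in> borel_measurable M"
proof -
  let ?D = "{w \<in> carrier_vec n. \<forall>j<n. vec_index w j \<in> \<rat>} :: real vec set"
  have dim: "dim_row (B \<omega>) = m" "dim_col (B \<omega>) = n" for \<omega> using carrier[of \<omega>] by auto
  have "(\<lambda>\<omega>. SUP w\<in>?D. vec_norm2 (mult_mat_vec (B \<omega>) w) / vec_norm2 w) \<in> borel_measurable M"
  proof (rule borel_measurable_cSUP[OF countable_rational_vecs])
    fix w assume "w \<in> ?D"
    then have w: "dim_vec w = n" by auto
    have "vec_norm2 (mult_mat_vec (B \<omega>) w)
        = sqrt (\<Sum>i<m. (\<Sum>j<n. B \<omega> $$ (i, j) * vec_index w j)\<^sup>2)" for \<omega>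
      using w dim by (simp add: vec_norm2_eq scalar_prod_def atLeast0LessThan)
    then show "(\<lambda>\<omega>. vec_norm2 (mult_mat_vec (B \<omega>) w) / vec_norm2 w) \<in> borel_measurable M"
      using entries by simp
  next
    fix \<omega>
    show "bdd_above ((\<lambda>w. vec_norm2 (mult_mat_vec (B \<omega>) w) / vec_norm2 w) ` ?D)"
      by (rule bdd_above_mono[OF bdd_above_operator_norm[of "B \<omega>"] image_mono]) (auto simp: dim)
  qed
  then show ?thesis by (simp add: operator_norm_eq_SUP_rational[OF carrier])
qed

text \<open>
  The probability in the theorem is a \<open>measure\<close>, which is zero on sets that are not measurable.
  Measurability of the event is therefore part of what has to be shown.
\<close>
lemma effective_rank_estimator_measurable:
  assumes Y: "\<And>\<omega>. Y \<omega> \<in> carrier_mat p q"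
    and entries: "\<And>i j. i < p \<Longrightarrow> j < q \<Longrightarrow> (\<lambda>\<omega>. Y \<omega> $$ (i, j)) \<in> borel_measurable M"
  shows "(\<lambda>\<omega>. effective_rank_estimator (Y \<omega>)) \<in> borel_measurable M"
proof -
  have dim: "dim_row (Y \<omega>) = p" "dim_col (Y \<omega>) = q" for \<omega> using Y[of \<omega>] by auto
  have gram: "(\<lambda>\<omega>. centered_gram (Y \<omega>) $$ (i, j)) \<in> borel_measurable M" if "i < q" "j < q" for i j
  proof -
    have "centered_gram (Y \<omega>) $$ (i, j)
        = (\<Sum>k<p. Y \<omega> $$ (k, i) * Y \<omega> $$ (k, j)) - real p * (if i = j then 1 else 0)" for \<omega>
      using that dim by (simp add: centered_gram_def scalar_prod_def atLeast0LessThan)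
    then show ?thesis using entries that by simp
  qed
  have [measurable]: "(\<lambda>\<omega>. operator_norm (centered_gram (Y \<omega>))) \<in> borel_measurable M"
    by (rule operator_norm_measurable[OF centered_gram_carrier[OF Y] gram])
  have "dim_row (centered_gram (Y \<omega>)) = q" for \<omega>
    using centered_gram_carrier[OF Y[of \<omega>]] by auto
  then have [measurable]: "(\<lambda>\<omega>. mat_trace (centered_gram (Y \<omega>))) \<in> borel_measurable M"
    using gram by (simp add: mat_trace_def)
  show ?thesis unfolding effective_rank_estimator_def by measurable
qed

section \<open>Deviation of the centered Gram matrix\<close>

text \<open>
  The centered Gram matrix is an unbiased estimator of \<open>A\<^sup>T A\<close>; this is its error.
\<close>
definition gram_deviation :: "real mat \<Rightarrow> real mat \<Rightarrow> real mat" where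
  "gram_deviation A Y = centered_gram Y - transpose_mat A * A"

lemma gram_deviation_carrier:
  "A \<in> carrier_mat p q \<Longrightarrow> Y \<in> carrier_mat p q \<Longrightarrow> gram_deviation A Y \<in> carrier_mat q q"
  unfolding gram_deviation_def by (intro minus_carrier_mat mult_carrier_mat[of _ _ p]) auto

lemma transpose_gram_deviation:
  assumes A: "A \<in> carrier_mat p q" and Y: "Y \<in> carrier_mat p q"
  shows "transpose_mat (gram_deviation A Y) = gram_deviation A Y"
  unfolding gram_deviation_def
  using transpose_minus[OF centered_gram_carrier[OF Y], of "transpose_mat A * A"] A
  by (simp add: transpose_centered_gram[OF Y] transpose_gram[OF A])

lemma gram_deviation_quadratic_form:
  assumes A: "A \<in> carrier_mat p q" and Y: "Y \<in> carrier_mat p q" and w: "w \<in> carrier_vec q"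
  shows "scalar_prod w (mult_mat_vec (gram_deviation A Y) w)
    = scalar_prod w (mult_mat_vec (centered_gram Y) w) - (vec_norm2 (mult_mat_vec A w))\<^sup>2"
proof -
  have G: "centered_gram Y \<in> carrier_mat q q" by (rule centered_gram_carrier[OF Y])
  have AA: "transpose_mat A * A \<in> carrier_mat q q" using A by simp
  show ?thesis
    using w G AA unfolding gram_deviation_def minus_mult_distrib_mat_vec[OF G AA w]
    by (subst scalar_prod_minus_distrib[of _ q]) (auto simp: gram_quadratic_form[OF A w])
qed

lemma sum_single_times: "(\<Sum>k\<in>{i} \<times> B. f k) = (\<Sum>j\<in>B. f (i, j))"
  using sum.cartesian_product[of "\<lambda>i j. f (i, j)" B "{i}"] by simp

text \<open>
  The coordinates of \<open>E w\<close>, written as sums over the index set of a row so that they fit the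
  general lemma on combinations.
\<close>
lemma iid_std_normal_mult_unit_vec:
  assumes w: "w \<in> carrier_vec q" and w1: "vec_norm2 w = 1"
    and p: "0 < p" and q: "0 < q"
  shows "iid_std_normal (std_normal_entries p q)
    (\<lambda>i E. \<Sum>k\<in>{i} \<times> {..<q}. vec_index w (snd k) * E k) {..<p}"
proof -
  interpret E: iid_std_normal "std_normal_entries p q" "\<lambda>k E. E k" "{..<p} \<times> {..<q}"
    by (rule iid_std_normal_entries[OF p q])
  have "(\<Sum>k\<in>{i} \<times> {..<q}. (vec_index w (snd k))\<^sup>2) = 1" for i :: nat
    using w w1 by (simp add: vec_norm2_eq sum_single_times)
  then show ?thesis
    by (intro E.orthonormal_combinations) (auto simp: disjoint_family_on_def)
qed

text \<open>
  For a unit vector the form equals \<open>|A w + E w|\<^sup>2 - p - |A w|\<^sup>2\<close>, a centered noncentral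
  chi-squared variable with \<open>p\<close> degrees of freedom. Its cross term \<open>2 (A w) \<bullet> (E w)\<close>, which in a direct
  expansion needs a separate argument, is absorbed in the noncentrality \<open>|A w|\<^sup>2\<close>.
\<close>
lemma gram_deviation_tail_unit:
  assumes A: "A \<in> carrier_mat p q" and p: "0 < p" and q: "0 < q" and t: "0 < t"
    and w: "w \<in> carrier_vec q" and w1: "vec_norm2 w = 1"
  shows "measure (std_normal_entries p q) {E \<in> space (std_normal_entries p q).
      4 * sqrt (t * (real p + (operator_norm A)\<^sup>2)) + 8 * t
        < \<bar>scalar_prod w (mult_mat_vec (gram_deviation A (A + Matrix.mat p q E)) w)\<bar>}
     \<le> 2 * exp (- t)"
proof -
  interpret iid_std_normal "std_normal_entries p q"
    "\<lambda>i E. \<Sum>k\<in>{i} \<times> {..<q}. vec_index w (snd k) * E k" "{..<p}"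
    by (rule iid_std_normal_mult_unit_vec[OF w w1 p q])
  let ?a = "vec_index (mult_mat_vec A w)"
  have a: "(\<Sum>i<p. (?a i)\<^sup>2) = (vec_norm2 (mult_mat_vec A w))\<^sup>2"
    using A by (simp add: vec_norm2_eq sum_nonneg)
  have "scalar_prod w (mult_mat_vec (gram_deviation A (A + Matrix.mat p q E)) w) = centered_sum ?a E" for E
  proof -
    let ?E = "Matrix.mat p q E"
    have Y: "A + ?E \<in> carrier_mat p q" using A by simp
    have "vec_index (mult_mat_vec (A + ?E) w) i
        = ?a i + (\<Sum>k\<in>{i} \<times> {..<q}. vec_index w (snd k) * E k)" if i: "i < p" for i
      using i A w
      by (simp add: add_mult_distrib_mat_vec[OF A, of ?E w] sum_single_times)
        (simp add: scalar_prod_def atLeast0LessThan mult.commute)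
    then have "(vec_norm2 (mult_mat_vec (A + ?E) w))\<^sup>2
        = (\<Sum>i<p. (?a i + (\<Sum>k\<in>{i} \<times> {..<q}. vec_index w (snd k) * E k))\<^sup>2)"
      using A by (simp add: vec_norm2_eq sum_nonneg)
    moreover have "scalar_prod w w = 1" using w1 vec_norm2_square[of w] by simp
    ultimately show ?thesis
      by (simp add: gram_deviation_quadratic_form[OF A Y w] centered_gram_quadratic_form[OF Y w]
          centered_sum_def a)
  qed
  moreover have "real (card {..<p}) + (\<Sum>i<p. (?a i)\<^sup>2) \<le> real p + (operator_norm A)\<^sup>2"
  proof -
    have "vec_norm2 (mult_mat_vec A w) \<le> operator_norm A"
      using vec_norm2_le_operator_norm[of w A] A w w1 by auto
    then show ?thesis unfolding a using vec_norm2_nonneg by (simp add: power_mono)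
  qed
  ultimately show ?thesis using centered_sum_tail[OF t] by simp
qed

lemma gram_deviation_measurable:
  assumes A: "A \<in> carrier_mat p q" and w: "w \<in> carrier_vec q"
  shows "(\<lambda>E. scalar_prod w (mult_mat_vec (gram_deviation A (A + Matrix.mat p q E)) w))
    \<in> borel_measurable (std_normal_entries p q)"
proof -
  have "scalar_prod w (mult_mat_vec (gram_deviation A (A + Matrix.mat p q E)) w)
    = (\<Sum>i<p. (\<Sum>j<q. (A $$ (i, j) + E (i, j)) * vec_index w j)\<^sup>2) - real p * scalar_prod w w
       - (vec_norm2 (mult_mat_vec A w))\<^sup>2" for E
  proof -
    have Y: "A + Matrix.mat p q E \<in> carrier_mat p q" using A by simp
    have "(vec_norm2 (mult_mat_vec (A + Matrix.mat p q E) w))\<^sup>2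
      = (\<Sum>i<p. (\<Sum>j<q. (A $$ (i, j) + E (i, j)) * vec_index w j)\<^sup>2)"
      using A w by (simp add: vec_norm2_eq sum_nonneg scalar_prod_def atLeast0LessThan)
    then show ?thesis
      by (simp add: gram_deviation_quadratic_form[OF A Y w] centered_gram_quadratic_form[OF Y w])
  qed
  moreover have "(\<lambda>E. E (i, j)) \<in> borel_measurable (std_normal_entries p q)" if "i < p" "j < q" for i j
    using that by (intro std_normal_entries_coordinate_measurable) auto
  ultimately show ?thesis by simp
qed

text \<open>
  Points of the net lie in the unit ball but not in general on the sphere; the form is homogeneous
  of degree two, so normalizing only increases it.
\<close>
lemma gram_deviation_tail:
  assumes A: "A \<in> carrier_mat p q" and p: "0 < p" and q: "0 < q" and t: "0 < t"
    and w: "w \<in> carrier_vec q" and w1: "vec_norm2 w \<le> 1"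
  shows "measure (std_normal_entries p q) {E \<in> space (std_normal_entries p q).
      4 * sqrt (t * (real p + (operator_norm A)\<^sup>2)) + 8 * t
        < \<bar>scalar_prod w (mult_mat_vec (gram_deviation A (A + Matrix.mat p q E)) w)\<bar>}
     \<le> 2 * exp (- t)" (is "measure ?P {E \<in> space ?P. ?x < ?Q w E} \<le> _")
proof -
  interpret prob_space ?P by (rule prob_space_std_normal_entries)
  have D: "gram_deviation A (A + Matrix.mat p q E) \<in> carrier_mat q q" for E
    using A by (intro gram_deviation_carrier) auto
  have x: "0 \<le> ?x" using t by simp
  show ?thesis
  proof (cases "vec_norm2 w = 0")
    case True
    then have "w = zero_vec q" using w vec_norm2_eq_0_iff by blast
    then have "?Q w E = 0" for E using D[of E] by auto
    then have empty: "{E \<in> space ?P. ?x < ?Q w E} = {}" using x by auto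
    show ?thesis unfolding empty by simp
  next
    case False
    then have r: "0 < vec_norm2 w" using vec_norm2_nonneg[of w] by linarith
    define u where "u = smult_vec (1 / vec_norm2 w) w"
    have u: "u \<in> carrier_vec q" "vec_norm2 u = 1"
      using w r by (simp_all add: u_def vec_norm2_smult)
    have wu: "w = smult_vec (vec_norm2 w) u" using r by (simp add: u_def smult_smult_assoc)
    have "?Q w E \<le> ?Q u E" for E
    proof -
      have "scalar_prod w (mult_mat_vec (gram_deviation A (A + Matrix.mat p q E)) w)
          = (vec_norm2 w)\<^sup>2 * scalar_prod u (mult_mat_vec (gram_deviation A (A + Matrix.mat p q E)) u)"
        using D[of E] u by (subst (1 2) wu) (simp add: mult_mat_vec[OF D] power2_eq_square)
      then have "?Q w E = (vec_norm2 w)\<^sup>2 * ?Q u E" by (simp add: abs_mult)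
      also have "\<dots> \<le> 1 * ?Q u E"
        using w1 r by (intro mult_right_mono) (simp_all add: power_le_one)
      finally show ?thesis by simp
    qed
    then have "{E \<in> space ?P. ?x < ?Q w E} \<subseteq> {E \<in> space ?P. ?x < ?Q u E}"
      by (auto intro: less_le_trans)
    moreover have "{E \<in> space ?P. ?x < ?Q u E} \<in> sets ?P"
      using gram_deviation_measurable[OF A u(1)] by measurable
    ultimately have "measure ?P {E \<in> space ?P. ?x < ?Q w E} \<le> measure ?P {E \<in> space ?P. ?x < ?Q u E}"
      by (rule finite_measure_mono)
    also have "\<dots> \<le> 2 * exp (- t)" by (rule gram_deviation_tail_unit[OF A p q t u])
    finally show ?thesis .
  qed
qed

text \<open>
  The trace of \<open>Y\<^sup>T Y\<close> is the sum of the squared entries of \<open>Y\<close>, so its error is a centered noncentral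
  chi-squared variable with \<open>p q\<close> degrees of freedom.
\<close>
lemma
  assumes A: "A \<in> carrier_mat p q" and p: "0 < p" and q: "0 < q" and t: "0 < t"
  shows trace_deviation_tail: "measure (std_normal_entries p q) {E \<in> space (std_normal_entries p q).
      4 * sqrt (t * (real p * real q + (frobenius_norm A)\<^sup>2)) + 8 * t
        < \<bar>mat_trace (centered_gram (A + Matrix.mat p q E)) - (frobenius_norm A)\<^sup>2\<bar>}
     \<le> 2 * exp (- t)"
    and mat_trace_centered_gram_measurable: "(\<lambda>E. mat_trace (centered_gram (A + Matrix.mat p q E)))
        \<in> borel_measurable (std_normal_entries p q)"
proof -
  interpret iid_std_normal "std_normal_entries p q" "\<lambda>k E. E k" "{..<p} \<times> {..<q}"
    by (rule iid_std_normal_entries[OF p q])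
  have F: "(frobenius_norm A)\<^sup>2 = (\<Sum>k\<in>{..<p} \<times> {..<q}. (A $$ k)\<^sup>2)"
    by (simp add: frobenius_norm_square[OF A] case_prod_unfold)
  have eq: "mat_trace (centered_gram (A + Matrix.mat p q E))
      = centered_sum (($$) A) E + (frobenius_norm A)\<^sup>2" for E
  proof -
    have "mat_trace (centered_gram (A + Matrix.mat p q E))
        = (\<Sum>k\<in>{..<p} \<times> {..<q}. (A $$ k + E k)\<^sup>2) - real (p * q)"
      using A by (subst mat_trace_centered_gram[of _ p q])
        (auto simp: case_prod_unfold intro!: sum.cong)
    then show ?thesis by (simp add: centered_sum_def F)
  qed
  show "measure (std_normal_entries p q) {E \<in> space (std_normal_entries p q).
      4 * sqrt (t * (real p * real q + (frobenius_norm A)\<^sup>2)) + 8 * t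
        < \<bar>mat_trace (centered_gram (A + Matrix.mat p q E)) - (frobenius_norm A)\<^sup>2\<bar>}
     \<le> 2 * exp (- t)"
    unfolding eq add_diff_cancel_right' by (rule centered_sum_tail[OF t]) (simp add: F)
  show "(\<lambda>E. mat_trace (centered_gram (A + Matrix.mat p q E))) \<in> borel_measurable (std_normal_entries p q)"
    unfolding eq by measurable
qed

text \<open>
  The squared operator norm of \<open>A\<close> is the supremum of \<open>|A v|\<^sup>2\<close> over the unit sphere, and the
  quadratic form of the centered Gram matrix differs from \<open>|A v|\<^sup>2\<close> by at most \<open>K |v|\<^sup>2\<close>. Comparing
  the forms in both directions compares the norms.
\<close>
lemma operator_norm_centered_gram_close:
  assumes A: "A \<in> carrier_mat p q" and Y: "Y \<in> carrier_mat p q" and "0 \<le> K"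
    and K: "\<And>v. v \<in> carrier_vec q \<Longrightarrow>
      \<bar>scalar_prod v (mult_mat_vec (gram_deviation A Y) v)\<bar> \<le> K * scalar_prod v v"
  shows "\<bar>operator_norm (centered_gram Y) - (operator_norm A)\<^sup>2\<bar> \<le> K"
proof -
  let ?G = "centered_gram Y" let ?L = "operator_norm A"
  have G: "?G \<in> carrier_mat q q" by (rule centered_gram_carrier[OF Y])
  have Av: "(vec_norm2 (mult_mat_vec A v))\<^sup>2 \<le> ?L\<^sup>2 * scalar_prod v v" if "v \<in> carrier_vec q" for v
    using vec_norm2_le_operator_norm[of v A] that A vec_norm2_nonneg
    by (auto simp flip: vec_norm2_square power_mult_distrib intro!: power_mono)
  have "operator_norm ?G \<le> ?L\<^sup>2 + K"
  proof (rule operator_norm_symmetric_le[OF G transpose_centered_gram[OF Y]])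
    fix v :: "real vec" assume v: "v \<in> carrier_vec q"
    show "\<bar>scalar_prod v (mult_mat_vec ?G v)\<bar> \<le> (?L\<^sup>2 + K) * scalar_prod v v"
      using K[OF v] Av[OF v] zero_le_power2[of "vec_norm2 (mult_mat_vec A v)"]
      unfolding gram_deviation_quadratic_form[OF A Y v] distrib_right by linarith
  qed (use \<open>0 \<le> K\<close> in simp)
  moreover have "?L\<^sup>2 \<le> operator_norm ?G + K"
  proof -
    have "?L \<le> sqrt (operator_norm ?G + K)"
    proof (rule operator_norm_le)
      fix v :: "real vec" assume "v \<in> carrier_vec (dim_col A)"
      then have v: "v \<in> carrier_vec q" using A by auto
      have "\<bar>scalar_prod v (mult_mat_vec ?G v)\<bar> \<le> vec_norm2 v * vec_norm2 (mult_mat_vec ?G v)"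
        using v G by (intro scalar_prod_le_vec_norm2[of _ q]) auto
      also have "\<dots> \<le> vec_norm2 v * (operator_norm ?G * vec_norm2 v)"
        using vec_norm2_le_operator_norm[of v ?G] v G vec_norm2_nonneg[of v]
        by (intro mult_left_mono) auto
      also have "\<dots> = operator_norm ?G * scalar_prod v v"
        by (simp add: power2_eq_square flip: vec_norm2_square)
      finally have "(vec_norm2 (mult_mat_vec A v))\<^sup>2 \<le> (operator_norm ?G + K) * (vec_norm2 v)\<^sup>2"
        using K[OF v] unfolding gram_deviation_quadratic_form[OF A Y v] distrib_right vec_norm2_square
        by linarith
      then have "sqrt ((vec_norm2 (mult_mat_vec A v))\<^sup>2) \<le> sqrt ((operator_norm ?G + K) * (vec_norm2 v)\<^sup>2)"
        by (rule real_sqrt_le_mono)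
      then show "vec_norm2 (mult_mat_vec A v) \<le> sqrt (operator_norm ?G + K) * vec_norm2 v"
        using vec_norm2_nonneg by (simp add: real_sqrt_mult)
    qed (use \<open>0 \<le> K\<close> operator_norm_nonneg in simp)
    then show ?thesis
      using operator_norm_nonneg[of A] operator_norm_nonneg[of ?G] \<open>0 \<le> K\<close>
      by (metis add_nonneg_nonneg power_mono real_sqrt_pow2)
  qed
  ultimately show ?thesis by linarith
qed

section \<open>Relative size of the errors\<close>

text \<open>
  Taking the maximum with \<open>1\<close> does not increase the error, since the true ratio is at least \<open>1\<close>.
  With \<open>R = F\<^sup>2 / L\<^sup>2\<close> the error of the quotient is \<open>((T - F\<^sup>2) - R (N - L\<^sup>2)) / N\<close>, and
  the denominator is at least \<open>L\<^sup>2 / 2\<close>.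
\<close>
lemma relative_error_of_quotient:
  fixes T N F L a b :: real
  assumes F: "0 < L" "L \<le> F" and T: "\<bar>T - F\<^sup>2\<bar> \<le> a" and N: "\<bar>N - L\<^sup>2\<bar> \<le> b" and b: "b \<le> L\<^sup>2 / 2"
  shows "\<bar>max (T / N) 1 - F\<^sup>2 / L\<^sup>2\<bar> / (F\<^sup>2 / L\<^sup>2) \<le> 2 * (a / F\<^sup>2 + b / L\<^sup>2)"
proof -
  let ?R = "F\<^sup>2 / L\<^sup>2"
  have L2: "0 < L\<^sup>2" "L\<^sup>2 \<le> F\<^sup>2" using F by (auto intro: power_mono)
  then have F2: "0 < F\<^sup>2" and R: "1 \<le> ?R" by (auto simp: le_divide_eq)
  have N2: "L\<^sup>2 / 2 \<le> N" using N b by linarith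
  then have Npos: "0 < N" using L2 by linarith
  have "\<bar>max (T / N) 1 - ?R\<bar> \<le> \<bar>T / N - ?R\<bar>" using R by (auto simp: max_def)
  also have "\<dots> = \<bar>(T - F\<^sup>2) - ?R * (N - L\<^sup>2)\<bar> / N"
    using Npos L2 by (simp add: field_simps abs_divide)
  also have "\<dots> \<le> (a + ?R * b) / N"
  proof (rule divide_right_mono)
    have "\<bar>?R * (N - L\<^sup>2)\<bar> = ?R * \<bar>N - L\<^sup>2\<bar>" using R by (simp only: abs_mult)
    also have "\<dots> \<le> ?R * b" using N R by (intro mult_left_mono) auto
    finally have "\<bar>?R * (N - L\<^sup>2)\<bar> \<le> ?R * b" .
    then show "\<bar>(T - F\<^sup>2) - ?R * (N - L\<^sup>2)\<bar> \<le> a + ?R * b" using T by linarith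
  qed (use Npos in simp)
  also have "\<dots> \<le> (a + ?R * b) / (L\<^sup>2 / 2)"
  proof (rule divide_left_mono[OF N2])
    have "0 \<le> a" "0 \<le> b" using T N by linarith+
    then show "0 \<le> a + ?R * b" using R by (intro add_nonneg_nonneg mult_nonneg_nonneg) auto
    show "0 < N * (L\<^sup>2 / 2)" using Npos L2(1) by (intro mult_pos_pos) linarith+
  qed
  finally have "\<bar>max (T / N) 1 - ?R\<bar> / ?R \<le> (a + ?R * b) / (L\<^sup>2 / 2) / ?R"
    using R by (intro divide_right_mono) auto
  also have "\<dots> = 2 * (a / F\<^sup>2 + b / L\<^sup>2)"
    using L2 F2 by (simp add: field_simps)
  finally show ?thesis .
qed

lemma sqrt_mult_add_le: "0 \<le> x \<Longrightarrow> 0 \<le> y \<Longrightarrow> 0 \<le> z \<Longrightarrow>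
    sqrt (x * (y + z\<^sup>2)) \<le> sqrt (x * y) + sqrt x * z"
  using sqrt_add_le_add_sqrt[of "x * y" "x * z\<^sup>2"]
  by (simp add: distrib_left real_sqrt_mult)

text \<open>
  Divided by \<open>F\<^sup>2\<close>, the terms \<open>sqrt t * F\<close> and \<open>t\<close> of the tail bound are each at most \<open>sqrt t / L\<close>,
  because \<open>sqrt t \<le> L \<le> F\<close>.
\<close>
lemma trace_deviation_bound:
  fixes p q t F L :: real
  assumes "0 < p" "0 < q" "0 < t" and L: "0 < L" "L \<le> F" "sqrt t \<le> L"
  shows "(4 * sqrt (t * (p * q + F\<^sup>2)) + 8 * t) / F\<^sup>2 \<le> 4 * (sqrt (p * q * t) / F\<^sup>2) + 12 * (sqrt t / L)"
proof -
  have F: "0 < F" using L by linarith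
  have Lsq: "L\<^sup>2 \<le> F\<^sup>2" using L by (intro power_mono) auto
  have "sqrt t * F / F\<^sup>2 \<le> sqrt t / L"
    using assms F by (simp add: power2_eq_square frac_le)
  moreover have "t / F\<^sup>2 \<le> sqrt t / L"
  proof -
    have "t / F\<^sup>2 \<le> t / L\<^sup>2" using assms Lsq by (intro frac_le) auto
    also have "\<dots> = (sqrt t / L) * (sqrt t / L)" using assms by (simp add: power2_eq_square)
    also have "\<dots> \<le> 1 * (sqrt t / L)" using assms by (intro mult_right_mono) auto
    finally show ?thesis by simp
  qed
  moreover have "(4 * sqrt (t * (p * q + F\<^sup>2)) + 8 * t) / F\<^sup>2
      \<le> (4 * (sqrt (p * q * t) + sqrt t * F) + 8 * t) / F\<^sup>2"
    using sqrt_mult_add_le[of t "p * q" F] assms F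
    by (intro divide_right_mono) (auto simp: mult_ac)
  moreover have "(4 * (sqrt (p * q * t) + sqrt t * F) + 8 * t) / F\<^sup>2
      = 4 * (sqrt (p * q * t) / F\<^sup>2) + 4 * (sqrt t * F / F\<^sup>2) + 8 * (t / F\<^sup>2)"
    by (simp add: add_divide_distrib distrib_left)
  ultimately show ?thesis by linarith
qed

text \<open>
  The left side is the tail bound at the level \<open>t + 6 q\<close>, where \<open>6 q\<close> pays for the union bound over
  the net. The term \<open>48 q\<close> is absorbed by \<open>sqrt (p q)\<close>, because \<open>q \<le> p\<close>.
\<close>
lemma spectral_deviation_bound:
  fixes p q t L :: real
  assumes pos: "0 < q" "q \<le> p" "0 < t" "0 \<le> L"
  shows "4 * sqrt ((t + 6 * q) * (p + L\<^sup>2)) + 8 * (t + 6 * q)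
    \<le> 60 * (sqrt (p * t) + sqrt (p * q)) + 12 * (sqrt q + sqrt t) * L + 8 * t"
proof -
  have q: "q \<le> sqrt (p * q)"
    using pos by (intro real_le_rsqrt) (simp add: power2_eq_square mult_right_mono)
  have "sqrt (6 * q) \<le> 3 * sqrt q"
    using pos by (simp add: real_sqrt_mult) (intro mult_right_mono real_le_lsqrt; simp)
  moreover have "sqrt (t + 6 * q) \<le> sqrt t + sqrt (6 * q)"
    using pos by (intro sqrt_add_le_add_sqrt) auto
  moreover have "0 \<le> sqrt t" using pos by simp
  ultimately have r: "sqrt (t + 6 * q) \<le> 3 * (sqrt q + sqrt t)"
    unfolding distrib_left by linarith
  have "sqrt ((t + 6 * q) * (p + L\<^sup>2)) \<le> sqrt (t + 6 * q) * sqrt p + sqrt (t + 6 * q) * L"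
    using sqrt_mult_add_le[of "t + 6 * q" p L] pos by (simp add: real_sqrt_mult)
  also have "\<dots> \<le> 3 * (sqrt q + sqrt t) * sqrt p + 3 * (sqrt q + sqrt t) * L"
    using r pos by (intro add_mono mult_right_mono) auto
  also have "3 * (sqrt q + sqrt t) * sqrt p = 3 * (sqrt (p * t) + sqrt (p * q))"
    by (simp add: real_sqrt_mult algebra_simps)
  finally have "sqrt ((t + 6 * q) * (p + L\<^sup>2))
      \<le> 3 * (sqrt (p * t) + sqrt (p * q)) + 3 * (sqrt q + sqrt t) * L" .
  moreover have "0 \<le> sqrt (p * t)" using pos by simp
  ultimately show ?thesis using q by (simp only: distrib_left distrib_right mult.assoc)
qed

text \<open>
  The factor \<open>200\<close> is chosen so that the spectral error is at most half of \<open>L\<^sup>2\<close>: it makes each of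
  \<open>sqrt (p q)\<close>, \<open>sqrt (p t)\<close> and \<open>t\<close> at most \<open>L\<^sup>2 / 200\<^sup>2\<close>, and \<open>sqrt q\<close> and
  \<open>sqrt t\<close> at most \<open>L / 200\<close>.
\<close>
lemma spectral_deviation_relative_bound:
  fixes p q t L :: real
  assumes pos: "0 < q" "q \<le> p" "0 < t"
    and L: "200 * (sqrt t + (p * q) powr (1 / 4) + (p * t) powr (1 / 4)) \<le> L"
  shows "0 < L" and "sqrt t \<le> L"
    and "2 * (4 * sqrt ((t + 6 * q) * (p + L\<^sup>2)) + 8 * (t + 6 * q)) \<le> L\<^sup>2 / 2"
    and "2 * (4 * sqrt ((t + 6 * q) * (p + L\<^sup>2)) + 8 * (t + 6 * q)) / L\<^sup>2
      \<le> 120 * ((sqrt (p * t) + sqrt (p * q)) / L\<^sup>2) + 40 * ((sqrt q + sqrt t) / L)"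
proof -
  let ?x = "4 * sqrt ((t + 6 * q) * (p + L\<^sup>2)) + 8 * (t + 6 * q)"
  have p: "0 < p" using pos by linarith
  have sqrt_powr: "sqrt z = (z powr (1 / 4))\<^sup>2" if "0 < z" for z :: real
  proof -
    have "(z powr (1 / 4))\<^sup>2 = z powr (1 / 4 + 1 / 4)" by (simp only: power2_eq_square powr_add)
    then show ?thesis using that by (simp add: powr_half_sqrt)
  qed
  have t0: "0 < sqrt t" using pos by simp
  define u where "u = (p * q) powr (1 / 4)"
  define v where "v = (p * t) powr (1 / 4)"
  have nn: "0 \<le> u" "0 \<le> v" by (simp_all add: u_def v_def)
  have "200 * (sqrt t + u + v) \<le> L" using L by (simp add: u_def v_def)
  then have small: "sqrt t \<le> L / 200" "u \<le> L / 200" "v \<le> L / 200"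
    using t0 nn by (auto simp only: distrib_left)
  show L0: "0 < L" and tL: "sqrt t \<le> L" using small t0 by linarith+
  have sq: "z\<^sup>2 \<le> L\<^sup>2 / 40000" if "0 \<le> z" "z \<le> L / 200" for z
    using power_mono[OF that(2,1), of 2] by (simp add: power_divide)
  have pq: "sqrt (p * q) \<le> L\<^sup>2 / 40000" and pt: "sqrt (p * t) \<le> L\<^sup>2 / 40000"
    using sq[OF nn(1) small(2)] sq[OF nn(2) small(3)] p pos by (simp_all add: sqrt_powr u_def v_def)
  have tt: "t \<le> L\<^sup>2 / 40000" using sq[OF _ small(1)] t0 pos by simp
  have "q * q \<le> p * q" using pos by (intro mult_right_mono) auto
  then have "q \<le> sqrt (p * q)" using pos by (intro real_le_rsqrt) (simp add: power2_eq_square)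
  then have "sqrt q \<le> sqrt ((L / 200)\<^sup>2)" using pq by (intro real_sqrt_le_mono) (simp add: power_divide)
  then have qL: "sqrt q \<le> L / 200" using L0 by simp
  have x: "?x \<le> 60 * (sqrt (p * t) + sqrt (p * q)) + 12 * (sqrt q + sqrt t) * L + 8 * t"
    using L0 pos by (intro spectral_deviation_bound) auto
  have "(sqrt q + sqrt t) * L \<le> (L / 100) * L"
    using qL small L0 by (intro mult_right_mono) auto
  then have "(sqrt q + sqrt t) * L \<le> L\<^sup>2 / 100" by (simp add: power2_eq_square)
  then have "?x \<le> L\<^sup>2 * (120 / 40000 + 12 / 100 + 8 / 40000)"
    using x pq pt tt by (simp add: algebra_simps)
  also have "\<dots> \<le> L\<^sup>2 * (1 / 4)"
  proof (rule mult_left_mono)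
    show "(120 / 40000 + 12 / 100 + 8 / 40000 :: real) \<le> 1 / 4" by simp
  qed simp
  finally show "2 * ?x \<le> L\<^sup>2 / 2" by simp
  have "t \<le> (sqrt q + sqrt t) * L"
  proof -
    have "t = sqrt t * sqrt t" using pos by simp
    also have "\<dots> \<le> (sqrt q + sqrt t) * L" using tL pos t0 L0 by (intro mult_mono) auto
    finally show ?thesis .
  qed
  then have "2 * ?x \<le> 120 * (sqrt (p * t) + sqrt (p * q)) + 40 * ((sqrt q + sqrt t) * L)"
    using x by (simp add: algebra_simps)
  then have "2 * ?x / L\<^sup>2 \<le> (120 * (sqrt (p * t) + sqrt (p * q)) + 40 * ((sqrt q + sqrt t) * L)) / L\<^sup>2"
    by (rule divide_right_mono) simp
  also have "\<dots> = 120 * ((sqrt (p * t) + sqrt (p * q)) / L\<^sup>2) + 40 * ((sqrt q + sqrt t) / L)"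
    using L0 by (simp add: add_divide_distrib power2_eq_square)
  finally show "2 * ?x / L\<^sup>2
      \<le> 120 * ((sqrt (p * t) + sqrt (p * q)) / L\<^sup>2) + 40 * ((sqrt q + sqrt t) / L)" .
qed

section \<open>Relative error of the effective rank estimator\<close>

text \<open>
  Union bound over the net at the level \<open>t + 6 q\<close>: the factor \<open>exp (6 q)\<close> from the number of points
  cancels. Passing from the net to the whole sphere costs the factor \<open>2\<close>.
\<close>
lemma operator_norm_deviation_tail:
  fixes A :: "real mat" and p q :: nat and t :: real
  assumes A: "A \<in> carrier_mat p q" and p: "0 < p" and q: "0 < q" and t: "0 < t"
  defines "x \<equiv> 4 * sqrt ((t + 6 * real q) * (real p + (operator_norm A)\<^sup>2)) + 8 * (t + 6 * real q)"
  shows "\<exists>B \<in> sets (std_normal_entries p q). measure (std_normal_entries p q) B \<le> 2 * exp (- t) \<and>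
    (\<forall>E \<in> space (std_normal_entries p q) - B.
      \<bar>operator_norm (centered_gram (A + Matrix.mat p q E)) - (operator_norm A)\<^sup>2\<bar> \<le> 2 * x)"
proof -
  let ?P = "std_normal_entries p q"
  let ?D = "\<lambda>E. gram_deviation A (A + Matrix.mat p q E)"
  let ?Q = "\<lambda>w E. \<bar>scalar_prod w (mult_mat_vec (?D E) w)\<bar>"
  let ?B = "\<lambda>w. {E \<in> space ?P. x < ?Q w E}"
  interpret prob_space ?P by (rule prob_space_std_normal_entries)
  have t6: "0 < t + 6 * real q" using t by simp
  have x0: "0 \<le> x" using t by (simp add: x_def)
  have Y: "A + Matrix.mat p q E \<in> carrier_mat p q" for E using A by simp
  have B: "?B w \<in> sets ?P" if "w \<in> lattice_net q" for w
    using gram_deviation_measurable[OF A lattice_net_carrier[OF that]] by measurable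
  have "prob (\<Union>w\<in>lattice_net q. ?B w) \<le> (\<Sum>w\<in>lattice_net q. prob (?B w))"
    using B by (intro finite_measure_subadditive_finite finite_lattice_net) auto
  also have "\<dots> \<le> (\<Sum>w\<in>lattice_net q. 2 * exp (- (t + 6 * real q)))"
    unfolding x_def
    by (intro sum_mono gram_deviation_tail[OF A p q t6] lattice_net_carrier lattice_net_norm)
  also have "\<dots> = real (card (lattice_net q)) * (2 * exp (- (t + 6 * real q)))" by simp
  also have "\<dots> \<le> exp (6 * real q) * (2 * exp (- (t + 6 * real q)))"
    by (intro mult_right_mono card_lattice_net_le) simp
  also have "\<dots> = 2 * exp (- t)"
    by (simp add: exp_add[symmetric] mult.left_commute)
  finally have prob: "prob (\<Union>w\<in>lattice_net q. ?B w) \<le> 2 * exp (- t)" .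
  have "\<bar>operator_norm (centered_gram (A + Matrix.mat p q E)) - (operator_norm A)\<^sup>2\<bar> \<le> 2 * x"
    if E: "E \<in> space ?P - (\<Union>w\<in>lattice_net q. ?B w)" for E
  proof (rule operator_norm_centered_gram_close[OF A Y])
    have "?Q w E \<le> x" if "w \<in> lattice_net q" for w
      using E that by (auto simp: not_less)
    moreover have "\<exists>w\<in>lattice_net q. w \<in> carrier_vec q \<and> vec_norm2 w \<le> 1 \<and> vec_norm2 (v - w) \<le> 1 / 4"
      if "v \<in> carrier_vec q" "vec_norm2 v = 1" for v
      using lattice_net_approx[OF that] lattice_net_carrier lattice_net_norm by blast
    ultimately show "?Q v E \<le> 2 * x * scalar_prod v v" if "v \<in> carrier_vec q" for v
      using quadratic_form_le_of_net[OF gram_deviation_carrier[OF A Y] transpose_gram_deviation[OF A Y]] that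
      by blast
  qed (use x0 in simp)
  then show ?thesis using prob B by (intro bexI[of _ "\<Union>w\<in>lattice_net q. ?B w"])
      (auto intro: finite_lattice_net)
qed

theorem proposition7p1:
  shows "\<exists>c>0. \<exists>c'>0. \<exists>c\<^sub>3>0. \<forall>(p::nat) (q::nat) (A::real mat) (t::real).
    2 \<le> q \<and> q \<le> p \<and> A \<in> carrier_mat p q \<and> 0 < t \<and>
    (frobenius_norm A)\<^sup>2 \<ge> c * (sqrt (real p * real q * t) + t) \<and>
    operator_norm A \<ge>
      c * (sqrt t + (real p * real q) powr (1/4) + (real p * t) powr (1/4))
    \<longrightarrow>
    measure (std_normal_entries p q)
      {E \<in> space (std_normal_entries p q).
         \<bar>effective_rank_estimator (A + Matrix.mat p q E) - effective_rank A\<bar> / effective_rank A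
         \<le> c' * (sqrt (real p * real q * t) / (frobenius_norm A)\<^sup>2
                 + (sqrt (real p * t) + sqrt (real p * real q)) / (operator_norm A)\<^sup>2
                 + (sqrt (real q) + sqrt t) / operator_norm A)}
    > 1 - c\<^sub>3 * exp (- t)"
proof (rule exI[of _ 200], intro conjI, simp, rule exI[of _ 240], intro conjI, simp,
    rule exI[of _ 5], intro conjI, simp, intro allI impI)
  fix p q :: nat and A :: "real mat" and t :: real
  assume H: "2 \<le> q \<and> q \<le> p \<and> A \<in> carrier_mat p q \<and> 0 < t \<and>
    (frobenius_norm A)\<^sup>2 \<ge> 200 * (sqrt (real p * real q * t) + t) \<and>
    operator_norm A \<ge>
      200 * (sqrt t + (real p * real q) powr (1/4) + (real p * t) powr (1/4))"
  let ?P = "std_normal_entries p q"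
  let ?F = "frobenius_norm A" and ?L = "operator_norm A"
  let ?Y = "\<lambda>E. A + Matrix.mat p q E"
  let ?T = "\<lambda>E. mat_trace (centered_gram (?Y E))"
  let ?N = "\<lambda>E. operator_norm (centered_gram (?Y E))"
  let ?err = "\<lambda>E. \<bar>effective_rank_estimator (?Y E) - effective_rank A\<bar> / effective_rank A"
  let ?X = "sqrt (real p * real q * t) / ?F\<^sup>2"
    and ?V = "(sqrt (real p * t) + sqrt (real p * real q)) / ?L\<^sup>2"
    and ?W = "(sqrt (real q) + sqrt t) / ?L"
  let ?a = "4 * sqrt (t * (real p * real q + ?F\<^sup>2)) + 8 * t"
  let ?b = "2 * (4 * sqrt ((t + 6 * real q) * (real p + ?L\<^sup>2)) + 8 * (t + 6 * real q))"
  interpret prob_space ?P by (rule prob_space_std_normal_entries)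
  have A: "A \<in> carrier_mat p q" and p: "0 < p" and q: "0 < q" and t: "0 < t" using H by auto
  have Y: "?Y E \<in> carrier_mat p q" for E using A by simp
  have rq: "0 < real q" and rp: "0 < real p" and qp: "real q \<le> real p" using H by auto
  note L = spectral_deviation_relative_bound[OF rq qp t, of ?L]
  have L0: "0 < ?L" and tL: "sqrt t \<le> ?L" and half: "?b \<le> ?L\<^sup>2 / 2"
    and b: "?b / ?L\<^sup>2 \<le> 120 * ?V + 40 * ?W"
    using L H by blast+
  \<comment> \<open>the constant \<open>240\<close> is twice the largest coefficient, \<open>120\<close>, of the two error bounds\<close>
  have a: "?a / ?F\<^sup>2 \<le> 4 * ?X + 12 * (sqrt t / ?L)"
    by (rule trace_deviation_bound[OF rp rq t L0 operator_norm_le_frobenius_norm tL])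

  obtain B where B: "B \<in> sets ?P" "prob B \<le> 2 * exp (- t)"
    and good: "\<And>E. E \<in> space ?P - B \<Longrightarrow> \<bar>?N E - ?L\<^sup>2\<bar> \<le> ?b"
    using operator_norm_deviation_tail[OF A p q t] by blast
  let ?C = "{E \<in> space ?P. ?a < \<bar>?T E - ?F\<^sup>2\<bar>}"
  have C: "?C \<in> sets ?P" using mat_trace_centered_gram_measurable[OF A p q t] by measurable
  let ?G = "{E \<in> space ?P. ?err E \<le> 240 * (?X + ?V + ?W)}"
  \<comment> \<open>needed to pass to the probability of the complement\<close>
  have G: "?G \<in> sets ?P"
  proof -
    have "(\<lambda>E. ?Y E $$ (i, j)) \<in> borel_measurable ?P" if "i < p" "j < q" for i j
      using that A std_normal_entries_coordinate_measurable[of "(i, j)" p q] by simp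
    from effective_rank_estimator_measurable[of ?Y, OF Y this] show ?thesis by measurable
  qed
  have "?err E \<le> 240 * (?X + ?V + ?W)" if E: "E \<in> space ?P - (B \<union> ?C)" for E
  proof -
    have "?err E \<le> 2 * (?a / ?F\<^sup>2 + ?b / ?L\<^sup>2)"
      unfolding effective_rank_estimator_def effective_rank_def
      using E good[of E] half L0 operator_norm_le_frobenius_norm[of A]
      by (intro relative_error_of_quotient) (auto simp: not_less)
    moreover have "sqrt t / ?L \<le> ?W" using L0 rq by (intro divide_right_mono) auto
    moreover have "0 \<le> ?X" "0 \<le> ?V" "0 \<le> ?W" using L0 t by auto
    ultimately show ?thesis using a b unfolding distrib_left by linarith
  qed
  then have "space ?P - ?G \<subseteq> B \<union> ?C" by blast
  then have "prob (space ?P - ?G) \<le> prob (B \<union> ?C)"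
    by (rule finite_measure_mono[OF _ sets.Un[OF B(1) C]])
  moreover have "prob (B \<union> ?C) \<le> prob B + prob ?C" by (rule measure_Un_le[OF B(1) C])
  moreover note B(2) trace_deviation_tail[OF A p q t] prob_compl[OF G]
  \<comment> \<open>the two exceptional events have total probability at most \<open>4 exp (- t)\<close>; the constant \<open>5\<close> makes the inequality strict\<close>
  moreover have "0 < exp (- t)" by simp
  ultimately show "1 - 5 * exp (- t) < prob ?G" by linarith
qed

end
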